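(* Let $(A;\{E_i\}_{i=0}^d;A^*;\{E^*_i\}_{i=0}^d)$ be a Leonard system in $\mathcal{A}$ with parameter array $(\{\theta_i\}_{i=0}^d;\{\theta^*_i\}_{i=0}^d;\{\varphi_i\}_{i=1}^d;\{\phi_i\}_{i=1}^d)$, switching element $S$ and dual switching element $S^*$. Then the following (i)--(iv) hold for $0\le i\le d$ (each assertion meaning that the operator acts on the stated one-dimensional subspace as multiplication by the stated scalar). (i) The eigenvalue of $S^*S^{-1}S^{*-1}S$ on the $i$th component of $[0^*D]$ is $$\frac{\phi_1\phi_2\cdots\phi_i}{\varphi_1\varphi_2\cdots\varphi_i}\cdot\frac{\varphi_1\varphi_2\cdots\varphi_{d-i}}{\phi_1\phi_2\cdots\phi_{d-i}}.$$ (ii) The eigenvalue of $S^*SS^{*-1}S^{-1}$ on the $i$th component of $[D^*D]$ is $$\frac{\varphi_d\varphi_{d-1}\cdots\varphi_{d-i+1}}{\phi_d\phi_{d-1}\cdots\phi_{d-i+1}}\cdot\frac{\phi_d\phi_{d-1}\cdots\phi_{i+1}}{\varphi_d\varphi_{d-1}\cdots\varphi_{i+1}}.$$ (iii) The eigenvalue of $S^{*-1}S^{-1}S^*S$ on the $i$th component of $[0^*0]$ is $$\frac{\varphi_1\varphi_2\cdots\varphi_i}{\phi_1\phi_2\cdots\phi_i}\cdot\frac{\phi_1\phi_2\cdots\phi_{d-i}}{\varphi_1\varphi_2\cdots\varphi_{d-i}}.$$ (iv) The eigenvalue of $S^{*-1}SS^*S^{-1}$ on the $i$th component of $[D^*0]$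 is $$\frac{\phi_d\phi_{d-1}\cdots\phi_{d-i+1}}{\varphi_d\varphi_{d-1}\cdots\varphi_{d-i+1}}\cdot\frac{\varphi_d\varphi_{d-1}\cdots\varphi_{i+1}}{\phi_d\phi_{d-1}\cdots\phi_{i+1}}.$$
   Context: $\mathbb{K}$ is a field, $d\ge 0$ an integer, $\mathcal{A}$ a $\mathbb{K}$-algebra isomorphic to $\mathrm{Mat}_{d+1}(\mathbb{K})$, $I$ its identity, and $V$ a simple left $\mathcal{A}$-module (so $\dim V=d+1$). The symbol $A^*$ is just a name for a second element (not a conjugate transpose). An element $A\in\mathcal{A}$ is multiplicity-free if it has $d+1$ mutually distinct eigenvalues in $\mathbb{K}$. For an ordering $\{\theta_i\}_{i=0}^d$ of these eigenvalues, the primitive idempotent of $A$ associated with $\theta_i$ is $E_i=\prod_{0\le j\le d,\,j\ne i}\frac{A-\theta_jI}{\theta_i-\theta_j}$. A Leonard system in $\mathcal{A}$ is a sequence $\Phi=(A;\{E_i\}_{i=0}^d;A^*;\{E^*_i\}_{i=0}^d)$ such that $A,A^*\in\mathcal{A}$ are multiplicity-free; $\{E_i\}_{i=0}^d$ (resp. $\{E^*_i\}_{i=0}^d$) is an ordering of the primitive idempotents of $A$ (resp. $A^*$); and for $0\le i,j\le d$ both $E_iA^*E_j$ and $E^*_iAE^*_j$ are zero if $|i-j|>1$ and nonzero if $|i-j|=1$. Let $\theta_i$ (resp. $\theta^*_i$) be the eigenvalue of $A$ (resp. $A^*$) associated with $E_i$ (resp. $E^*_i$). Put $\tau_i=(\lambda-\theta_0)(\lambda-\theta_1)\cdots(\lambda-\theta_{i-1})$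 and $\eta_i=(\lambda-\theta_d)(\lambda-\theta_{d-1})\cdots(\lambda-\theta_{d-i+1})$ for $0\le i\le d$. The first and second split sequences of $\Phi$ are, for $1\le i\le d$, $\varphi_i=(\theta^*_0-\theta^*_i)\frac{\mathrm{tr}(\tau_i(A)E^*_0)}{\mathrm{tr}(\tau_{i-1}(A)E^*_0)}$ and $\phi_i=(\theta^*_0-\theta^*_i)\frac{\mathrm{tr}(\eta_i(A)E^*_0)}{\mathrm{tr}(\eta_{i-1}(A)E^*_0)}$ (the denominators are known to be nonzero, and all $\varphi_i,\phi_i$ are known to be nonzero). The parameter array of $\Phi$ is $(\{\theta_i\}_{i=0}^d;\{\theta^*_i\}_{i=0}^d;\{\varphi_i\}_{i=1}^d;\{\phi_i\}_{i=1}^d)$. The switching element for $\Phi$ is $S=\sum_{r=0}^d\frac{\phi_d\phi_{d-1}\cdots\phi_{d-r+1}}{\varphi_1\varphi_2\cdots\varphi_r}E_r$. The dual switching element $S^*$ for $\Phi$ is the switching element of the Leonard system $\Phi^*=(A^*;\{E^*_i\}_{i=0}^d;A;\{E_i\}_{i=0}^d)$; explicitly $S^*=\sum_{r=0}^d\frac{\phi_1\phi_2\cdots\phi_r}{\varphi_1\varphi_2\cdots\varphi_r}E^*_r$. Both $S$ and $S^*$ are invertible. Flags: $[0],[D],[0^*],[D^*]$ are the sequences of subspaces of $V$, indexed by $0\le i\le d$, whose $i$th components are respectively $E_0V+\cdots+E_iV$; $E_dV+E_{d-1}V+\cdots+E_{d-i}V$; $E^*_0V+\cdots+E^*_iV$;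 $E^*_dV+E^*_{d-1}V+\cdots+E^*_{d-i}V$. These are known to be mutually opposite. For distinct $z,w\in\{0,D,0^*,D^*\}$, $[zw]$ denotes the induced decomposition of $V$, i.e. the sequence of one-dimensional subspaces with direct sum $V$ whose $i$th component ($0\le i\le d$) is the intersection of the $i$th component of $[z]$ and the $(d-i)$th component of $[w]$. *)

theory Defs
  imports
    "Jordan_Normal_Form.Char_Poly"
    "HOL-Library.Set_Algebras"
begin

text \<open>
  The algebra is a type \<open>'a\<close> of class \<^class>\<open>ring_1\<close> with a scalar multiplication
  \<open>scale\<close> by a field \<open>'k\<close>; \<open>rep\<close> is an isomorphism onto the algebra of square matrices of
  size \<open>d + 1\<close>.  Eigenvalues and traces of elements are those of the representing matrices.
\<close>

locale full_matrix_algebra = vector_space scale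
  for d :: nat
    and scale :: "'k::field \<Rightarrow> 'a::ring_1 \<Rightarrow> 'a"
    and rep :: "'a \<Rightarrow> 'k mat" +
  assumes scale_mult_left: "scale c x * y = scale c (x * y)"
    and scale_mult_right: "x * scale c y = scale c (x * y)"
    and rep_bij: "bij_betw rep UNIV (carrier_mat (d + 1) (d + 1))"
    and rep_add: "rep (x + y) = rep x + rep y"
    and rep_scale: "rep (scale c x) = c \<cdot>\<^sub>m rep x"
    and rep_mult: "rep (x * y) = rep x * rep y"
    and rep_one: "rep 1 = 1\<^sub>m (d + 1)"

text \<open>The library's modules are over commutative rings, so left modules are introduced here.\<close>

locale left_module =
  fixes act :: "'a::ring_1 \<Rightarrow> 'v::ab_group_add \<Rightarrow> 'v"
  assumes act_add_left: "act (x + y) v = act x v + act y v"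
    and act_add_right: "act x (v + w) = act x v + act x w"
    and act_mult: "act (x * y) v = act x (act y v)"
    and act_one: "act 1 v = v"

definition left_submodule :: "('a::ring_1 \<Rightarrow> 'v::ab_group_add \<Rightarrow> 'v) \<Rightarrow> 'v set \<Rightarrow> bool" where
  "left_submodule act W \<longleftrightarrow>
     0 \<in> W \<and> (\<forall>v\<in>W. \<forall>w\<in>W. v + w \<in> W) \<and> (\<forall>x. \<forall>v\<in>W. act x v \<in> W)"

locale simple_left_module = left_module act
  for act :: "'a::ring_1 \<Rightarrow> 'v::ab_group_add \<Rightarrow> 'v" +
  assumes nontrivial: "\<exists>v::'v. v \<noteq> 0"
    and simple: "left_submodule act W \<Longrightarrow> W = {0} \<or> W = UNIV"

definition mat_trace :: "'k::comm_monoid_add mat \<Rightarrow> 'k" where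
  "mat_trace M = (\<Sum>i<dim_row M. M $$ (i, i))"

definition alg_inverse :: "'a::monoid_mult \<Rightarrow> 'a" where
  "alg_inverse x = (THE y. x * y = 1 \<and> y * x = 1)"

definition poly_eval :: "('k::field \<Rightarrow> 'a::ring_1 \<Rightarrow> 'a) \<Rightarrow> 'k poly \<Rightarrow> 'a \<Rightarrow> 'a" where
  "poly_eval scale p x = (\<Sum>n\<le>degree p. scale (coeff p n) (x ^ n))"

definition multiplicity_free :: "nat \<Rightarrow> ('a::ring_1 \<Rightarrow> 'k::field mat) \<Rightarrow> 'a \<Rightarrow> bool" where
  "multiplicity_free d rep x \<longleftrightarrow> card {t. eigenvalue (rep x) t} = d + 1"

definition eigenvalue_ordering ::
    "nat \<Rightarrow> ('a::ring_1 \<Rightarrow> 'k::field mat) \<Rightarrow> 'a \<Rightarrow> (nat \<Rightarrow> 'k) \<Rightarrow> bool" where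
  "eigenvalue_ordering d rep x \<theta> \<longleftrightarrow> bij_betw \<theta> {..d} {t. eigenvalue (rep x) t}"

definition primitive_idempotent ::
    "nat \<Rightarrow> ('k::field \<Rightarrow> 'a::ring_1 \<Rightarrow> 'a) \<Rightarrow> 'a \<Rightarrow> (nat \<Rightarrow> 'k) \<Rightarrow> nat \<Rightarrow> 'a" where
  "primitive_idempotent d scale x \<theta> i =
     (\<Prod>j\<leftarrow>filter (\<lambda>j. j \<noteq> i) [0..<Suc d]. scale (1 / (\<theta> i - \<theta> j)) (x - scale (\<theta> j) 1))"

definition idempotents_for ::
    "nat \<Rightarrow> ('k::field \<Rightarrow> 'a::ring_1 \<Rightarrow> 'a) \<Rightarrow> ('a \<Rightarrow> 'k mat) \<Rightarrow> 'a \<Rightarrow> (nat \<Rightarrow> 'a) \<Rightarrow> (nat \<Rightarrow> 'k) \<Rightarrow> bool"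
  where
  "idempotents_for d scale rep x E \<theta> \<longleftrightarrow>
     eigenvalue_ordering d rep x \<theta> \<and> (\<forall>i\<le>d. E i = primitive_idempotent d scale x \<theta> i)"

text \<open>Sequences indexed by \<open>0, \<dots>, d\<close> are functions on \<^typ>\<open>nat\<close>; values beyond \<open>d\<close> are ignored.\<close>

record 'a leonard_data =
  elt :: 'a
  idem :: "nat \<Rightarrow> 'a"
  elt_dual :: 'a
  idem_dual :: "nat \<Rightarrow> 'a"

definition dual :: "'a leonard_data \<Rightarrow> 'a leonard_data" where
  "dual \<Phi> = \<lparr>elt = elt_dual \<Phi>, idem = idem_dual \<Phi>, elt_dual = elt \<Phi>, idem_dual = idem \<Phi>\<rparr>"

definition tridiagonal_pattern :: "nat \<Rightarrow> (nat \<Rightarrow> 'a::ring_1) \<Rightarrow> 'a \<Rightarrow> bool" where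
  "tridiagonal_pattern d E x \<longleftrightarrow>
     (\<forall>i\<le>d. \<forall>j\<le>d.
        (\<bar>int i - int j\<bar> > 1 \<longrightarrow> E i * x * E j = 0) \<and>
        (\<bar>int i - int j\<bar> = 1 \<longrightarrow> E i * x * E j \<noteq> 0))"

definition leonard_system ::
    "nat \<Rightarrow> ('k::field \<Rightarrow> 'a::ring_1 \<Rightarrow> 'a) \<Rightarrow> ('a \<Rightarrow> 'k mat) \<Rightarrow> 'a leonard_data \<Rightarrow> bool" where
  "leonard_system d scale rep \<Phi> \<longleftrightarrow>
     multiplicity_free d rep (elt \<Phi>) \<and> multiplicity_free d rep (elt_dual \<Phi>) \<and>
     (\<exists>\<theta>. idempotents_for d scale rep (elt \<Phi>) (idem \<Phi>) \<theta>) \<and>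
     (\<exists>\<theta>'. idempotents_for d scale rep (elt_dual \<Phi>) (idem_dual \<Phi>) \<theta>') \<and>
     tridiagonal_pattern d (idem \<Phi>) (elt_dual \<Phi>) \<and>
     tridiagonal_pattern d (idem_dual \<Phi>) (elt \<Phi>)"

text \<open>
  The ordering of the eigenvalues is determined on \<open>{..d}\<close> by the ordering of the primitive
  idempotents.  The dual eigenvalues of \<open>\<Phi>\<close> are the eigenvalues of \<open>dual \<Phi>\<close>.
\<close>

definition eigval ::
    "nat \<Rightarrow> ('k::field \<Rightarrow> 'a::ring_1 \<Rightarrow> 'a) \<Rightarrow> ('a \<Rightarrow> 'k mat) \<Rightarrow> 'a leonard_data \<Rightarrow> nat \<Rightarrow> 'k" where
  "eigval d scale rep \<Phi> i =
     (THE t. \<exists>\<theta>. idempotents_for d scale rep (elt \<Phi>) (idem \<Phi>) \<theta> \<and> \<theta> i = t)"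

definition tau :: "(nat \<Rightarrow> 'k::field) \<Rightarrow> nat \<Rightarrow> 'k poly" where
  "tau \<theta> i = (\<Prod>j<i. [:- \<theta> j, 1:])"

definition eta :: "nat \<Rightarrow> (nat \<Rightarrow> 'k::field) \<Rightarrow> nat \<Rightarrow> 'k poly" where
  "eta d \<theta> i = (\<Prod>j<i. [:- \<theta> (d - j), 1:])"

definition first_split ::
    "nat \<Rightarrow> ('k::field \<Rightarrow> 'a::ring_1 \<Rightarrow> 'a) \<Rightarrow> ('a \<Rightarrow> 'k mat) \<Rightarrow> 'a leonard_data \<Rightarrow> nat \<Rightarrow> 'k" where
  "first_split d scale rep \<Phi> i =
     (let \<theta> = eigval d scale rep \<Phi>; \<theta>' = eigval d scale rep (dual \<Phi>);
          tr = (\<lambda>p. mat_trace (rep (poly_eval scale p (elt \<Phi>) * idem_dual \<Phi> 0)))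
      in (\<theta>' 0 - \<theta>' i) * (tr (tau \<theta> i) / tr (tau \<theta> (i - 1))))"

definition second_split ::
    "nat \<Rightarrow> ('k::field \<Rightarrow> 'a::ring_1 \<Rightarrow> 'a) \<Rightarrow> ('a \<Rightarrow> 'k mat) \<Rightarrow> 'a leonard_data \<Rightarrow> nat \<Rightarrow> 'k" where
  "second_split d scale rep \<Phi> i =
     (let \<theta> = eigval d scale rep \<Phi>; \<theta>' = eigval d scale rep (dual \<Phi>);
          tr = (\<lambda>p. mat_trace (rep (poly_eval scale p (elt \<Phi>) * idem_dual \<Phi> 0)))
      in (\<theta>' 0 - \<theta>' i) * (tr (eta d \<theta> i) / tr (eta d \<theta> (i - 1))))"

definition parameter_array ::
    "nat \<Rightarrow> ('k::field \<Rightarrow> 'a::ring_1 \<Rightarrow> 'a) \<Rightarrow> ('a \<Rightarrow> 'k mat) \<Rightarrow> 'a leonard_data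
      \<Rightarrow> (nat \<Rightarrow> 'k) \<Rightarrow> (nat \<Rightarrow> 'k) \<Rightarrow> (nat \<Rightarrow> 'k) \<Rightarrow> (nat \<Rightarrow> 'k) \<Rightarrow> bool" where
  "parameter_array d scale rep \<Phi> \<theta> \<theta>' \<phi>\<^sub>1 \<phi>\<^sub>2 \<longleftrightarrow>
     (\<forall>i\<in>{0..d}. \<theta> i = eigval d scale rep \<Phi> i \<and> \<theta>' i = eigval d scale rep (dual \<Phi>) i) \<and>
     (\<forall>i\<in>{1..d}. \<phi>\<^sub>1 i = first_split d scale rep \<Phi> i \<and> \<phi>\<^sub>2 i = second_split d scale rep \<Phi> i)"

definition switching_element ::
    "nat \<Rightarrow> ('k::field \<Rightarrow> 'a::ring_1 \<Rightarrow> 'a) \<Rightarrow> ('a \<Rightarrow> 'k mat) \<Rightarrow> 'a leonard_data \<Rightarrow> 'a" where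
  "switching_element d scale rep \<Phi> =
     (\<Sum>r\<le>d. scale ((\<Prod>j\<in>{d - r + 1..d}. second_split d scale rep \<Phi> j) /
                   (\<Prod>j\<in>{1..r}. first_split d scale rep \<Phi> j)) (idem \<Phi> r))"

definition dual_switching_element ::
    "nat \<Rightarrow> ('k::field \<Rightarrow> 'a::ring_1 \<Rightarrow> 'a) \<Rightarrow> ('a \<Rightarrow> 'k mat) \<Rightarrow> 'a leonard_data \<Rightarrow> 'a" where
  "dual_switching_element d scale rep \<Phi> = switching_element d scale rep (dual \<Phi>)"

text \<open>
  In the sums of subspaces below, \<open>\<Sum>\<close> is the elementwise (Minkowski) sum of sets from
  \<^theory>\<open>HOL-Library.Set_Algebras\<close>.
\<close>

datatype flag_label = F0 | FD | F0' | FD'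

fun flag ::
    "nat \<Rightarrow> ('a::ring_1 \<Rightarrow> 'v::ab_group_add \<Rightarrow> 'v) \<Rightarrow> 'a leonard_data \<Rightarrow> flag_label \<Rightarrow> nat \<Rightarrow> 'v set"
  where
    "flag d act \<Phi> F0 i = (\<Sum>j\<le>i. range (act (idem \<Phi> j)))"
  | "flag d act \<Phi> FD i = (\<Sum>j\<le>i. range (act (idem \<Phi> (d - j))))"
  | "flag d act \<Phi> F0' i = (\<Sum>j\<le>i. range (act (idem_dual \<Phi> j)))"
  | "flag d act \<Phi> FD' i = (\<Sum>j\<le>i. range (act (idem_dual \<Phi> (d - j))))"

definition decomposition ::
    "nat \<Rightarrow> ('a::ring_1 \<Rightarrow> 'v::ab_group_add \<Rightarrow> 'v) \<Rightarrow> 'a leonard_data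
      \<Rightarrow> flag_label \<Rightarrow> flag_label \<Rightarrow> nat \<Rightarrow> 'v set" where
  "decomposition d act \<Phi> z w i = flag d act \<Phi> z i \<inter> flag d act \<Phi> w (d - i)"

text \<open>The field acts on the module through the scalar multiples of the identity.\<close>

definition acts_as_scalar ::
    "('k::field \<Rightarrow> 'a::ring_1 \<Rightarrow> 'a) \<Rightarrow> ('a \<Rightarrow> 'v::ab_group_add \<Rightarrow> 'v) \<Rightarrow> 'a \<Rightarrow> 'v set \<Rightarrow> 'k \<Rightarrow> bool"
  where
  "acts_as_scalar scale act x W c \<longleftrightarrow> (\<forall>v\<in>W. act x v = act (scale c 1) v)"

end

theory Submission
  imports Defs
begin

text \<open>
  On \<open>V\<close> write \<open>A\<close>, \<open>B\<close> for the two operators of the Leonard system, \<open>E i\<close>, \<open>F i\<close> for the projections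
  onto their eigenlines, and \<open>\<tau> i\<close>, \<open>\<eta> i\<close> for the polynomials \<open>tau\<close>, \<open>eta\<close> evaluated at \<open>A\<close>.  The switching
  element \<open>S\<close> commutes with \<open>A\<close>, hence with \<open>\<tau> i\<close> and \<open>\<eta> i\<close>, and its coefficients are
  chosen such that it maps \<open>F 0 V\<close> to \<open>F d V\<close> (lemma \<open>switching\<close>).  Dually \<open>S'\<close> commutes with \<open>B\<close>
  and maps \<open>E 0 V\<close> to \<open>E d V\<close>.

  Choose \<open>v \<noteq> 0\<close> in \<open>F 0 V\<close> and put \<open>w = S v\<close>, a nonzero vector of \<open>F d V\<close>.  The lines in question are
  spanned by vectors obtained from \<open>v\<close> and \<open>w\<close> by polynomials in \<open>A\<close> (lemma \<open>component\<close>): \<open>\<tau> i v\<close> spans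
  the \<open>i\<close>th component of \<open>[0*D]\<close>, \<open>\<tau> i w\<close> that of \<open>[D*D]\<close>, \<open>\<eta> i v\<close> that of \<open>[0*0]\<close> and \<open>\<eta> i w\<close>
  that of \<open>[D*0]\<close>.  Thus \<open>S\<close> maps \<open>\<tau> i v\<close> to \<open>\<tau> i w\<close> and \<open>\<eta> i v\<close> to \<open>\<eta> i w\<close>.  Because \<open>S'\<close> fixes
  the flags \<open>[0*]\<close>, \<open>[D*]\<close> and carries \<open>[0]\<close> to \<open>[D]\<close>, it maps \<open>\<eta> i v\<close> to a multiple of \<open>\<tau> i v\<close>, and
  \<open>\<eta> i w\<close> to a multiple of \<open>\<tau> i w\<close>.  So each of the four products runs once around the square with the
  corners \<open>\<tau> i v\<close>, \<open>\<tau> i w\<close>, \<open>\<eta> i w\<close>, \<open>\<eta> i v\<close>, and its eigenvalue is a quotient of the two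
  multiples.  These are computed by recursion on \<open>i\<close>: the split sequences are exactly the scalars in
  \<open>(B - \<theta>'\<^sub>i) (\<tau> i v) = \<phi>\<^sub>i (\<tau> (i - 1) v)\<close> and its analogues, and \<open>S'\<close> commutes with \<open>B\<close>.  The
  first multiple is \<open>\<alpha> i\<close>, the product of the quotients of the second by the first split sequence up
  to \<open>i\<close>; the second one is \<open>\<alpha> (d - i)\<close> (lemmas \<open>G_eta\<close>, \<open>G_eta_S\<close>).

  The analogues for \<open>w\<close> are the split sequences of the systems in which the order of the \<open>F i\<close> is
  reversed.  They are expressed by those of the given system in \<open>split_sequence_reverse\<close> and
  \<open>split_sequence_flip_F\<close>.

  The passage from the algebra to operators on \<open>V\<close> uses that a primitive idempotent of an
  element with \<open>d + 1\<close> distinct eigenvalues is a matrix of rank one, and that a simple module over a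
  full matrix algebra is faithful.
\<close>

section \<open>Operators with one-dimensional eigenspaces\<close>

text \<open>
  The operator with eigenvalue \<open>th j\<close> on the image of the projection \<open>E j\<close>.  The two operators of a
  Leonard system and both switching elements, with their inverses, have this form.
\<close>
definition diag_op :: "('k::field \<Rightarrow> 'v::ab_group_add \<Rightarrow> 'v) \<Rightarrow> nat \<Rightarrow> (nat \<Rightarrow> 'v \<Rightarrow> 'v) \<Rightarrow> (nat \<Rightarrow> 'k) \<Rightarrow> 'v \<Rightarrow> 'v"
  where "diag_op sc d E th v = (\<Sum>j\<le>d. sc (th j) (E j v))"

text \<open>
  With the eigenvalues of \<open>T\<close> for \<open>t\<close>, in increasing or decreasing order of the index, these are the
  polynomials \<^const>\<open>tau\<close> and \<^const>\<open>eta\<close> at \<open>T\<close>, applied to \<open>v\<close>.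
\<close>
primrec newton ::
    "('k::field \<Rightarrow> 'v::ab_group_add \<Rightarrow> 'v) \<Rightarrow> ('v \<Rightarrow> 'v) \<Rightarrow> (nat \<Rightarrow> 'k) \<Rightarrow> nat \<Rightarrow> 'v \<Rightarrow> 'v" where
  "newton sc T t 0 v = v"
| "newton sc T t (Suc n) v = T (newton sc T t n v) - sc (t n) (newton sc T t n v)"

abbreviation (input) flip :: "nat \<Rightarrow> (nat \<Rightarrow> 'b) \<Rightarrow> nat \<Rightarrow> 'b" where
  "flip d f \<equiv> \<lambda>i. f (d - i)"

lemma sum_flip: "(\<Sum>j\<le>d. f (d - j)) = (\<Sum>j\<le>(d::nat). f j)"
  by (rule sum.reindex_bij_witness[of _ "\<lambda>j. d - j" "\<lambda>j. d - j"]) auto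

lemma diag_op_flip: "diag_op sc d (flip d E) (flip d th) = diag_op sc d E th"
  unfolding diag_op_def using sum_flip[of "\<lambda>j. sc (th j) (E j _)"] by auto

text \<open>
  The axiom \<open>E_line\<close> says that the projections have rank at most one, without a choice of basis vectors.
\<close>
locale eigenspaces = vector_space sc
  for sc :: "'k::field \<Rightarrow> 'v::ab_group_add \<Rightarrow> 'v" (infixr "*s" 75) +
  fixes d :: nat and E :: "nat \<Rightarrow> 'v \<Rightarrow> 'v" and th :: "nat \<Rightarrow> 'k"
  assumes E_linear: "i \<le> d \<Longrightarrow> Vector_Spaces.linear sc sc (E i)"
    and E_E: "\<lbrakk>i \<le> d; j \<le> d\<rbrakk> \<Longrightarrow> E i (E j v) = (if i = j then E j v else 0)"
    and E_sum: "(\<Sum>i\<le>d. E i v) = v"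
    and E_line: "\<lbrakk>i \<le> d; E i x \<noteq> 0\<rbrakk> \<Longrightarrow> \<exists>c. E i y = c *s E i x"
    and E_nontrivial: "i \<le> d \<Longrightarrow> \<exists>v. E i v \<noteq> 0"
    and th_inj: "inj_on th {..d}"
begin

sublocale pair: vector_space_pair sc sc ..

lemma th_eq: "\<lbrakk>i \<le> d; j \<le> d\<rbrakk> \<Longrightarrow> th i = th j \<longleftrightarrow> i = j"
  using th_inj by (auto simp: inj_on_def)

lemma E_simps:
  assumes "i \<le> d"
  shows "E i 0 = 0" "E i (v + w) = E i v + E i w" "E i (v - w) = E i v - E i w"
    "E i (c *s v) = c *s E i v" "E i (sum f S) = (\<Sum>x\<in>S. E i (f x))"
  using pair.linear_0[OF E_linear[OF assms]] pair.linear_add[OF E_linear[OF assms]]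
    pair.linear_diff[OF E_linear[OF assms]] pair.linear_scale[OF E_linear[OF assms]]
    pair.linear_sum[OF E_linear[OF assms]] by auto

lemma E_ext:
  assumes "\<And>j. j \<le> d \<Longrightarrow> E j v = E j w" shows "v = w"
  using E_sum[of v] E_sum[of w] assms by (metis (no_types, lifting) atMost_iff sum.cong)

lemma E_diag: "j \<le> d \<Longrightarrow> E j (diag_op sc d E g v) = g j *s E j v"
  by (simp add: diag_op_def E_simps E_E if_distrib[of "\<lambda>x. _ *s x"] cong: if_cong)

lemma diag_diff: "diag_op sc d E g (v - w) = diag_op sc d E g v - diag_op sc d E g w"
  by (rule E_ext) (simp add: E_diag E_simps scale_right_diff_distrib)

lemma diag_add: "diag_op sc d E g (v + w) = diag_op sc d E g v + diag_op sc d E g w"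
  by (rule E_ext) (simp add: E_diag E_simps scale_right_distrib)

lemma diag_scale: "diag_op sc d E g (c *s v) = c *s diag_op sc d E g v"
  by (rule E_ext) (simp add: E_diag E_simps scale_left_commute)

lemma diag_zero: "diag_op sc d E g 0 = 0"
  by (rule E_ext) (simp add: E_diag E_simps)

lemma diag_sum: "diag_op sc d E g (sum f S) = (\<Sum>x\<in>S. diag_op sc d E g (f x))"
  by (rule E_ext) (simp add: E_diag E_simps scale_sum_right)

lemmas diag_simps = diag_diff diag_add diag_scale diag_zero diag_sum

lemma diag_commute: "diag_op sc d E g (diag_op sc d E h v) = diag_op sc d E h (diag_op sc d E g v)"
  by (rule E_ext) (simp add: E_diag scale_left_commute)

abbreviation A where "A \<equiv> diag_op sc d E th"
abbreviation N where "N \<equiv> newton sc A"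

lemma E_newton: "j \<le> d \<Longrightarrow> E j (N t n v) = (\<Prod>k<n. th j - t k) *s E j v"
  by (induction n) (simp_all add: E_simps E_diag algebra_simps)

lemma diag_newton: "diag_op sc d E g (N t n v) = N t n (diag_op sc d E g v)"
  by (rule E_ext) (simp add: E_newton E_diag scale_left_commute)

lemma newton_linear:
  "N t n (v + w) = N t n v + N t n w" "N t n (v - w) = N t n v - N t n w"
  "N t n (c *s v) = c *s N t n v" "N t n 0 = 0" "N t n (sum f S) = (\<Sum>x\<in>S. N t n (f x))"
  by (rule E_ext, simp add: E_newton E_simps scale_right_distrib scale_right_diff_distrib
        scale_left_commute scale_sum_right)+

lemma E_fixed: "\<lbrakk>i \<le> d; j \<le> d; E i v = v\<rbrakk> \<Longrightarrow> E j v = (if i = j then v else 0)"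
  using E_E[of j i v] by (metis (full_types))

lemma eigenvector_iff: "i \<le> d \<Longrightarrow> A v = th i *s v \<longleftrightarrow> E i v = v"
proof
  assume i: "i \<le> d" and v: "A v = th i *s v"
  have "E j v = 0" if "j \<le> d" "j \<noteq> i" for j
  proof -
    have "th j *s E j v = th i *s E j v"
      using arg_cong[OF v, of "E j"] unfolding E_diag[OF that(1)] E_simps(4)[OF that(1)] .
    hence "th j = th i \<or> E j v = 0" by (simp only: scale_cancel_right)
    thus ?thesis using that(2) th_eq[OF that(1) i] by blast
  qed
  hence "E j (E i v) = E j v" if "j \<le> d" for j
    using E_E[OF that i, of v] that by (cases "j = i") simp_all
  thus "E i v = v" by (rule E_ext)
next
  assume i: "i \<le> d" and v: "E i v = v"
  show "A v = th i *s v"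
  proof (rule E_ext)
    fix j assume j: "j \<le> d"
    show "E j (A v) = E j (th i *s v)"
      unfolding E_diag[OF j] E_simps(4)[OF j] E_fixed[OF i j v] by simp
  qed
qed

lemma eigenvector_exists: "i \<le> d \<Longrightarrow> \<exists>v. v \<noteq> 0 \<and> E i v = v"
  using E_nontrivial[of i] E_E[of i i] by auto

lemma flip: "eigenspaces sc d (flip d E) (flip d th)"
proof (intro eigenspaces.intro eigenspaces_axioms.intro vector_space_axioms)
  show "(\<Sum>i\<le>d. E (d - i) v) = v" for v
    using sum_flip[of "\<lambda>j. E j v" d] by (simp add: E_sum)
  show "inj_on (flip d th) {..d}"
  proof (rule inj_onI)
    fix x y assume "x \<in> {..d}" "y \<in> {..d}" "th (d - x) = th (d - y)"
    thus "x = y" using th_eq[of "d - x" "d - y"] by simp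
  qed
  show "E (d - i) (E (d - j) v) = (if i = j then E (d - j) v else 0)" if "i \<le> d" "j \<le> d" for i j v
  proof -
    have "d - i = d - j \<longleftrightarrow> i = j" using that by arith
    thus ?thesis by (simp add: E_E)
  qed
  show "\<exists>c. E (d - i) y = c *s E (d - i) x" if "E (d - i) x \<noteq> 0" for i x y
    using E_line[OF _ that] by simp
  show "\<exists>v. E (d - i) v \<noteq> 0" for i
    using E_nontrivial[of "d - i"] diff_le_self by blast
  show "Vector_Spaces.linear sc sc (E (d - i))" for i
    by (rule E_linear[OF diff_le_self])
qed

end

section \<open>Irreducible tridiagonal action\<close>

text \<open>
  One half of a Leonard system.  What follows from this half alone can be used with \<open>E\<close> and \<open>F\<close>
  exchanged and with either order reversed.
\<close>
locale tridiagonal_action = A: eigenspaces sc d E th + B: eigenspaces sc d F th'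
  for sc :: "'k::field \<Rightarrow> 'v::ab_group_add \<Rightarrow> 'v" (infixr "*s" 75)
    and d E th F th' +
  assumes far: "\<lbrakk>i \<le> d; j \<le> d; i + 1 < j \<or> j + 1 < i\<rbrakk> \<Longrightarrow> F i (A.A (F j v)) = 0"
    and near: "\<lbrakk>i \<le> d; j \<le> d; i = j + 1 \<or> j = i + 1\<rbrakk> \<Longrightarrow> \<exists>v. F i (A.A (F j v)) \<noteq> 0"
begin

lemma F_A: "i \<le> d \<Longrightarrow> F i (A.A v) = (\<Sum>j\<le>d. F i (A.A (F j v)))"
  using arg_cong[OF B.E_sum[of v], of "\<lambda>x. F i (A.A x)"] by (simp add: A.diag_simps B.E_simps)

lemma F_A_zero:
  assumes "i \<le> d" "\<And>j. \<lbrakk>j \<le> d; j \<le> i + 1; i \<le> j + 1\<rbrakk> \<Longrightarrow> F j v = 0"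
  shows "F i (A.A v) = 0"
proof (subst F_A[OF assms(1)], intro sum.neutral ballI)
  fix j assume "j \<in> {..d}"
  hence j: "j \<le> d" by simp
  show "F i (A.A (F j v)) = 0"
  proof (cases "i + 1 < j \<or> j + 1 < i")
    case False
    hence "j \<le> i + 1" "i \<le> j + 1" by simp_all
    hence "F j v = 0" by (rule assms(2)[OF j])
    thus ?thesis using assms(1) by (simp only: A.diag_zero B.E_simps)
  qed (rule far[OF assms(1) j])
qed

lemma F_A_single:
  assumes "i \<le> d" "k \<le> d" "\<And>j. \<lbrakk>j \<le> d; j \<noteq> k; j \<le> i + 1; i \<le> j + 1\<rbrakk> \<Longrightarrow> F j v = 0"
  shows "F i (A.A v) = F i (A.A (F k v))"
proof -
  have "F i (A.A (v - F k v)) = 0"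
  proof (rule F_A_zero[OF assms(1)])
    fix j assume "j \<le> d" "j \<le> i + 1" "i \<le> j + 1"
    thus "F j (v - F k v) = 0"
      using assms(3)[of j] assms(2) by (cases "j = k") (simp_all add: B.E_simps B.E_E)
  qed
  thus ?thesis using assms(1) by (simp add: A.diag_simps B.E_simps)
qed

lemma near_nonzero:
  assumes "i \<le> d" "j \<le> d" "i = j + 1 \<or> j = i + 1" "F j v \<noteq> 0"
  shows "F i (A.A (F j v)) \<noteq> 0"
proof
  assume 0: "F i (A.A (F j v)) = 0"
  obtain w where w: "F i (A.A (F j w)) \<noteq> 0" using near[OF assms(1-3)] by auto
  obtain c where "F j w = c *s F j v" using B.E_line[OF assms(2,4)] by blast
  thus False using w 0 assms by (simp add: A.diag_simps B.E_simps)
qed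

text \<open>
  A tridiagonal operator raises the filtration of \<open>V\<close> by the sums of \<open>F 0 V, \<dots>, F m V\<close> by one step only.
\<close>
lemma F_newton_zero:
  assumes "\<And>j. \<lbrakk>j \<le> d; m < j\<rbrakk> \<Longrightarrow> F j v = 0" "j \<le> d" "m + n < j"
  shows "F j (A.N t n v) = 0"
  using assms(2,3)
proof (induction n arbitrary: j)
  case (Suc n)
  have "F j (A.A (A.N t n v)) = 0" by (rule F_A_zero) (use Suc in auto)
  thus ?case using Suc by (simp add: B.E_simps)
qed (use assms in auto)

text \<open>
  The subdiagonal entries do not vanish, so every factor really raises the degree.
\<close>
lemma F_newton_top:
  assumes "F 0 v = v" "v \<noteq> 0" "j \<le> d"
  shows "F j (A.N t j v) \<noteq> 0"
  using assms(3)
proof (induction j)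
  case (Suc j)
  have z: "F k (A.N t j v) = 0" if "k \<le> d" "j < k" for k
    by (rule F_newton_zero[of 0]) (use that assms B.E_fixed[of 0] in auto)
  have "F (Suc j) (A.A (A.N t j v)) = F (Suc j) (A.A (F j (A.N t j v)))"
    by (rule F_A_single) (use Suc z in auto)
  moreover have "\<dots> \<noteq> 0" by (rule near_nonzero) (use Suc in auto)
  ultimately show ?case using Suc z by (simp add: B.E_simps)
qed (use assms in auto)

lemma newton_F_zero: "\<lbrakk>F 0 v = v; j \<le> d; n < j\<rbrakk> \<Longrightarrow> F j (A.N t n v) = 0"
  by (rule F_newton_zero[of 0]) (auto simp: B.E_fixed[of 0])

text \<open>
  By the two preceding lemmas the vectors \<open>N t k v\<close> with \<open>k \<le> i\<close> are triangular, with nonzero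
  diagonal, with respect to the lines \<open>F 0 V, \<dots>, F i V\<close>.
\<close>
lemma newton_span:
  assumes v: "F 0 v = v" "v \<noteq> 0" and "i \<le> d" "\<And>j. \<lbrakk>j \<le> d; i < j\<rbrakk> \<Longrightarrow> F j x = 0"
  shows "\<exists>c. x = (\<Sum>k\<le>i. c k *s A.N t k v)"
  using assms(3,4)
proof (induction i arbitrary: x)
  case 0
  obtain c where "F 0 x = c *s F 0 v" using B.E_line[of 0 v x] v by auto
  moreover have "x = F 0 x" using 0 by - (rule B.E_ext, auto simp: B.E_E)
  ultimately show ?case using v by auto
next
  case (Suc i)
  obtain b where b: "F (Suc i) x = b *s F (Suc i) (A.N t (Suc i) v)"
    using B.E_line[OF Suc.prems(1) F_newton_top[OF v Suc.prems(1)]] by blast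
  have "\<exists>c. x - b *s A.N t (Suc i) v = (\<Sum>k\<le>i. c k *s A.N t k v)"
  proof (rule Suc.IH)
    fix j assume j: "j \<le> d" "i < j"
    show "F j (x - b *s A.N t (Suc i) v) = 0"
    proof (cases "j = Suc i")
      case False
      thus ?thesis using j Suc.prems(2)[of j] newton_F_zero[OF v(1), of j "Suc i" t]
        by (simp add: B.E_simps del: newton.simps)
    qed (use b j in \<open>simp add: B.E_simps del: newton.simps\<close>)
  qed (use Suc in simp)
  then obtain c where c: "x - b *s A.N t (Suc i) v = (\<Sum>k\<le>i. c k *s A.N t k v)" by blast
  have "x = (\<Sum>k\<le>Suc i. (c(Suc i := b)) k *s A.N t k v)"
    using c by (simp add: algebra_simps del: newton.simps)
  thus ?case by blast
qed

lemma newton_span_all: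
  assumes "F 0 v = v" "v \<noteq> 0"
  shows "\<exists>c. x = (\<Sum>k\<le>d. c k *s A.N t k v)"
  by (rule newton_span) (use assms in auto)

text \<open>
  The vector \<open>v\<close> is cyclic for \<open>A\<close>, and \<open>E j v = 0\<close> would force \<open>E j\<close> to vanish on everything
  generated from \<open>v\<close>.
\<close>
lemma E_nonzero:
  assumes v: "F 0 v = v" "v \<noteq> 0" and j: "j \<le> d"
  shows "E j v \<noteq> 0"
proof
  assume 0: "E j v = 0"
  obtain x where x: "E j x \<noteq> 0" using A.E_nontrivial[OF j] by blast
  obtain c where "x = (\<Sum>k\<le>d. c k *s A.N th k v)" using newton_span_all[OF v] by blast
  thus False using x j 0 by (simp add: A.E_simps A.E_newton)
qed

text \<open>
  The \<open>i\<close>th component of \<open>[0*D]\<close> is the line spanned by \<open>\<tau> i v\<close>.  In the expansion of \<open>x\<close> in the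
  vectors \<open>\<tau> k v\<close> the conditions \<open>E 0 x = 0\<close>, \<open>E 1 x = 0\<close> and so on kill one coefficient after the other,
  as \<open>E j\<close> kills \<open>\<tau> k v\<close> for \<open>k > j\<close>.
\<close>
lemma component:
  assumes v: "F 0 v = v" "v \<noteq> 0" and i: "i \<le> d"
    and lo: "\<And>j. \<lbrakk>j \<le> d; i < j\<rbrakk> \<Longrightarrow> F j x = 0" and hi: "\<And>j. j < i \<Longrightarrow> E j x = 0"
  shows "\<exists>c. x = c *s A.N th i v"
proof -
  obtain c where c: "x = (\<Sum>k\<le>i. c k *s A.N th k v)" using newton_span[OF v i lo] by blast
  have "c k = 0" if "k < i" for k
    using that
  proof (induction k rule: less_induct)
    case (less k)
    have kd: "k \<le> d" using less i by simp
    have "(\<Sum>l\<le>i. c l *s E k (A.N th l v)) = (\<Sum>l\<in>{k}. c l *s E k (A.N th l v))"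
    proof (rule sum.mono_neutral_right)
      show "\<forall>l\<in>{..i} - {k}. c l *s E k (A.N th l v) = 0"
      proof
        fix l assume l: "l \<in> {..i} - {k}"
        show "c l *s E k (A.N th l v) = 0"
        proof (cases "l < k")
          case False
          hence "(\<Prod>m<l. th k - th m) = 0" using l by (intro prod_zero) auto
          thus ?thesis using kd by (simp add: A.E_newton)
        qed (use less in auto)
      qed
    qed (use less in auto)
    hence "c k *s (\<Prod>m<k. th k - th m) *s E k v = E k x"
      using kd by (simp add: c A.E_simps A.E_newton)
    hence "c k *s (\<Prod>m<k. th k - th m) *s E k v = 0" using hi less by simp
    moreover have "(\<Prod>m<k. th k - th m) \<noteq> 0" using kd by (auto simp: A.th_eq)
    ultimately show ?case using E_nonzero[OF v kd] by simp
  qed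
  hence "x = (\<Sum>k\<in>{i}. c k *s A.N th k v)"
    unfolding c by (intro sum.mono_neutral_right) auto
  thus ?thesis by auto
qed

lemma flip_E: "tridiagonal_action sc d (flip d E) (flip d th) F th'"
proof -
  interpret e: eigenspaces sc d "flip d E" "flip d th" by (rule A.flip)
  show ?thesis by unfold_locales (auto simp: diag_op_flip far near)
qed

lemma flip_F: "tridiagonal_action sc d E th (flip d F) (flip d th')"
proof -
  interpret e: eigenspaces sc d "flip d F" "flip d th'" by (rule B.flip)
  show ?thesis by unfold_locales (auto intro!: far near)
qed

end

section \<open>Leonard systems and their split sequences\<close>
locale leonard = AB: tridiagonal_action sc d E th F th' + BA: tridiagonal_action sc d F th' E th
  for sc :: "'k::field \<Rightarrow> 'v::ab_group_add \<Rightarrow> 'v" (infixr "*s" 75)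
    and d E th F th'
begin

abbreviation A where "A \<equiv> diag_op sc d E th"
abbreviation B where "B \<equiv> diag_op sc d F th'"

lemma dual: "leonard sc d F th' E th"
  by (intro leonard.intro AB.tridiagonal_action_axioms BA.tridiagonal_action_axioms)

lemma flip_E: "leonard sc d (flip d E) (flip d th) F th'"
  by (intro leonard.intro AB.flip_E BA.flip_F)

lemma flip_F: "leonard sc d E th (flip d F) (flip d th')"
  by (intro leonard.intro AB.flip_F BA.flip_E)

lemma newton_low_zero: "\<lbrakk>j < i; i \<le> d\<rbrakk> \<Longrightarrow> E j (newton sc A th i v) = 0"
proof -
  assume "j < i" "i \<le> d"
  moreover from this have "(\<Prod>k<i. th j - th k) = 0" by (intro prod_zero) auto
  ultimately show ?thesis by (simp add: AB.A.E_newton)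
qed

lemma newton_nonzero: "\<lbrakk>F 0 v = v; v \<noteq> 0; i \<le> d\<rbrakk> \<Longrightarrow> newton sc A t i v \<noteq> 0"
  using AB.F_newton_top[of v i t] by (auto simp: AB.B.E_simps)

text \<open>
  The vector on the left lies in component \<open>i\<close> of \<open>[0*D]\<close>: subtracting \<open>th' (Suc i)\<close> removes the
  part in \<open>F (Suc i) V\<close>, while \<open>B\<close>, being tridiagonal on the lines \<open>E j V\<close>, goes down by at most one.
\<close>
lemma split_scalar_exists:
  assumes v: "F 0 v = v" "v \<noteq> 0" and i: "i < d"
  shows "\<exists>c. B (newton sc A th (Suc i) v) - th' (Suc i) *s newton sc A th (Suc i) v
           = c *s newton sc A th i v"
proof (rule AB.component[OF v])
  let ?u = "newton sc A th (Suc i) v"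
  fix j assume "j \<le> d" "i < j"
  thus "F j (B ?u - th' (Suc i) *s ?u) = 0"
    using AB.newton_F_zero[OF v(1), of j "Suc i" th]
    by (cases "j = Suc i") (simp_all add: AB.B.E_simps AB.B.E_diag del: newton.simps)
next
  let ?u = "newton sc A th (Suc i) v"
  fix j assume j: "j < i"
  have "E j (B ?u) = 0"
    by (rule BA.F_A_zero) (use i j newton_low_zero[of _ "Suc i" v] in \<open>auto simp del: newton.simps\<close>)
  thus "E j (B ?u - th' (Suc i) *s ?u) = 0"
    using i j newton_low_zero[of j "Suc i" v] by (simp add: AB.A.E_simps del: newton.simps)
qed (use i in simp)

text \<open>
  If \<open>m > 0\<close> were the least index with \<open>E m v \<noteq> 0\<close>, then \<open>B v\<close> would have a nonzero part in
  \<open>E (m - 1) V\<close>, which is impossible for a multiple of \<open>v\<close>.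
\<close>
lemma eigenvector_E_0:
  assumes i: "i \<le> d" and v: "F i v = v" "v \<noteq> 0"
  shows "E 0 v \<noteq> 0"
proof -
  define m where "m = (LEAST j. j \<le> d \<and> E j v \<noteq> 0)"
  have "\<exists>j. j \<le> d \<and> E j v \<noteq> 0"
    using AB.A.E_ext[of v 0] v(2) by (auto simp: AB.A.E_simps)
  hence m: "m \<le> d" "E m v \<noteq> 0"
    unfolding m_def by (metis (mono_tags, lifting) LeastI_ex)+
  have less: "E j v = 0" if "j < m" for j
    using not_less_Least[OF that[unfolded m_def]] that m(1) by auto
  show ?thesis
  proof (cases m)
    case (Suc k)
    have "E k (B v) = E k (B (E m v))"
      by (rule BA.F_A_single) (use Suc m less in auto)
    moreover have "\<dots> \<noteq> 0"
      by (rule BA.near_nonzero) (use Suc m in auto)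
    moreover have "B v = th' i *s v" using AB.B.eigenvector_iff[OF i] v by blast
    ultimately show ?thesis using less[of k] Suc m(1) by (simp add: AB.A.E_simps)
  qed (use m in simp)
qed

text \<open>
  Otherwise \<open>\<tau> (i + 1) v\<close> would be an eigenvector of \<open>B\<close> killed by \<open>E 0\<close>.
\<close>
lemma split_scalar_nonzero:
  assumes v: "F 0 v = v" "v \<noteq> 0" and i: "i < d"
    and eq: "B (newton sc A th (Suc i) v) - th' (Suc i) *s newton sc A th (Suc i) v
           = c *s newton sc A th i v"
  shows "c \<noteq> 0"
proof
  let ?u = "newton sc A th (Suc i) v"
  have Suc: "Suc i \<le> d" using i by simp
  assume "c = 0"
  hence "B ?u = th' (Suc i) *s ?u" using eq by (simp del: newton.simps)
  hence "F (Suc i) ?u = ?u" using AB.B.eigenvector_iff[OF Suc] by blast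
  thus False
    using eigenvector_E_0[OF Suc _ newton_nonzero[OF v Suc]] newton_low_zero[of 0 "Suc i" v] Suc
    by (simp del: newton.simps)
qed

lemma F_0_newton_nonzero:
  assumes v: "F 0 v = v" "v \<noteq> 0" and "i \<le> d"
  shows "F 0 (newton sc A th i v) \<noteq> 0"
  using assms(3)
proof (induction i)
  case (Suc i)
  let ?u = "newton sc A th (Suc i) v"
  have i: "i < d" using Suc by simp
  obtain c where c: "B ?u - th' (Suc i) *s ?u = c *s newton sc A th i v"
    using split_scalar_exists[OF v i] by blast
  have "(th' 0 - th' (Suc i)) *s F 0 ?u = c *s F 0 (newton sc A th i v)"
    using arg_cong[OF c, of "F 0"]
    by (simp add: AB.B.E_simps AB.B.E_diag AB.A.scale_left_diff_distrib del: newton.simps)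
  moreover have "c *s F 0 (newton sc A th i v) \<noteq> 0"
    using split_scalar_nonzero[OF v i c] Suc by simp
  ultimately show ?case by (auto simp del: newton.simps)
qed (use v in simp)

end

text \<open>
  The split sequence as a structure constant: the scalars with which \<open>B\<close> lowers the basis \<open>\<tau> i v\<close>.  In
  contrast to the trace formula this form can be transported along symmetries of the system.
\<close>
definition split_sequence where
  "split_sequence sc d E th F th' ph \<longleftrightarrow>
     (\<forall>v. F 0 v = v \<longrightarrow> (\<forall>i<d.
        diag_op sc d F th' (newton sc (diag_op sc d E th) th (Suc i) v)
          - sc (th' (Suc i)) (newton sc (diag_op sc d E th) th (Suc i) v)
        = sc (ph (Suc i)) (newton sc (diag_op sc d E th) th i v)))"

context leonard begin

lemma split_sequence_nonzero:
  assumes "split_sequence sc d E th F th' ph" "i \<in> {1..d}"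
  shows "ph i \<noteq> 0"
proof -
  obtain v where v: "F 0 v = v" "v \<noteq> 0" using AB.B.eigenvector_exists[of 0] by auto
  obtain k where k: "i = Suc k" "k < d" using assms(2) by (cases i) auto
  show ?thesis
    using split_scalar_nonzero[OF v k(2)] assms(1) v(1) k unfolding split_sequence_def by blast
qed

text \<open>
  The trace formula for the split sequence: applying \<open>F 0\<close> to the lowering relation gives
  \<open>(th' 0 - th' i) t\<^sub>i = \<phi>\<^sub>i t\<^bsub>i - 1\<^esub>\<close>, where \<open>t\<^sub>i\<close> is the \<open>F 0\<close>-coordinate of \<open>\<tau> i v\<close>.
\<close>
lemma split_sequenceI:
  assumes t: "\<And>v i. \<lbrakk>F 0 v = v; i \<le> d\<rbrakk> \<Longrightarrow> F 0 (newton sc A th i v) = t i *s v"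
    and ph: "\<And>i. i \<in> {1..d} \<Longrightarrow> ph i = (th' 0 - th' i) * (t i / t (i - 1))"
  shows "split_sequence sc d E th F th' ph"
  unfolding split_sequence_def
proof (intro allI impI)
  fix v i assume v: "F 0 v = v" and i: "i < d"
  let ?u = "newton sc A th (Suc i) v"
  show "B ?u - th' (Suc i) *s ?u = ph (Suc i) *s newton sc A th i v"
  proof (cases "v = 0")
    case False
    obtain c where c: "B ?u - th' (Suc i) *s ?u = c *s newton sc A th i v"
      using split_scalar_exists[OF v False i] by blast
    have nz: "t i \<noteq> 0" using F_0_newton_nonzero[OF v False, of i] t[OF v, of i] i by auto
    have "(th' 0 - th' (Suc i)) *s F 0 ?u = c *s F 0 (newton sc A th i v)"
      using arg_cong[OF c, of "F 0"]
      by (simp add: AB.B.E_simps AB.B.E_diag AB.A.scale_left_diff_distrib del: newton.simps)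
    hence "((th' 0 - th' (Suc i)) * t (Suc i)) *s v = (c * t i) *s v"
      using t[OF v, of i] t[OF v, of "Suc i"] i by (simp del: newton.simps)
    hence "(th' 0 - th' (Suc i)) * t (Suc i) = c * t i"
      using False by (simp only: AB.A.scale_cancel_right) blast
    hence "c = ph (Suc i)" using nz ph[of "Suc i"] i by (simp add: field_simps)
    thus ?thesis using c by simp
  qed (simp add: AB.A.newton_linear AB.A.diag_zero AB.B.diag_zero del: newton.simps)
qed

text \<open>
  Reversing both orders reverses the split sequence.  The point is the dual relation
  \<open>F d \<circ> \<eta> (i + 1) \<circ> (B - th' (d - i - 1)) = \<phi>\<^bsub>d - i\<^esub> (F d \<circ> \<eta> i)\<close>, an identity between
  maps to the line \<open>F d V\<close>.  It can be checked on the basis \<open>\<tau> j v\<^sub>0\<close> with \<open>v\<^sub>0\<close> in \<open>F 0 V\<close>, because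
  \<open>F d (\<eta> n (\<tau> j v\<^sub>0))\<close> vanishes unless \<open>n + j = d\<close>.  Evaluating it at a vector of \<open>F d V\<close> and
  comparing with the \<open>F d\<close>-coordinate of the lowering relation of the reversed system shows that both
  have the same scalar.
\<close>
lemma split_sequence_reverse:
  assumes ph: "split_sequence sc d E th F th' ph"
  shows "split_sequence sc d (flip d E) (flip d th) (flip d F) (flip d th') (\<lambda>i. ph (Suc d - i))"
  unfolding split_sequence_def diag_op_flip
proof (intro allI impI)
  fix v i assume v: "F (d - 0) v = v" and i: "i < d"
  let ?N = "newton sc A"
  let ?eta = "?N (flip d th)"
  interpret fl: leonard sc d "flip d E" "flip d th" "flip d F" "flip d th'"
    by (rule leonard.flip_F[OF flip_E])
  show "B (?eta (Suc i) v) - th' (d - Suc i) *s ?eta (Suc i) v = ph (Suc d - Suc i) *s ?eta i v"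
  proof (cases "v = 0")
    case False
    obtain c where c: "B (?eta (Suc i) v) - th' (d - Suc i) *s ?eta (Suc i) v = c *s ?eta i v"
      using fl.split_scalar_exists[OF v False i] unfolding diag_op_flip by blast
    obtain v0 where v0: "F 0 v0 = v0" "v0 \<noteq> 0" using AB.B.eigenvector_exists[of 0] by auto
    define e where "e n j = F d (?eta n (?N th j v0))" for n j
    \<comment> \<open>for \<open>n + j < d\<close> the degree in \<open>A\<close> is too small to reach \<open>F d V\<close>\<close>
    have e_low: "e n j = 0" if "n + j < d" for n j
      unfolding e_def
      by (rule AB.F_newton_zero[of j]) (use that AB.newton_F_zero[OF v0(1)] in auto)
    \<comment> \<open>for \<open>n + j > d\<close> every eigenvalue of \<open>A\<close> is a root of one of the two polynomials\<close>
    have e_high: "e n j = 0" if "n \<le> d" "j \<le> d" "d < n + j" for n j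
    proof -
      have "?eta n (?N th j v0) = 0"
      proof (rule AB.A.E_ext)
        fix k assume k: "k \<le> d"
        show "E k (?eta n (?N th j v0)) = E k 0"
        proof (cases "k < j")
          case True
          thus ?thesis using k that newton_low_zero[of k j v0]
            by (simp add: AB.A.E_newton[of k "flip d th" n] AB.A.E_simps)
        next
          case False
          have "(\<Prod>m<n. th k - th (d - m)) = 0"
            using False that k by (intro prod_zero bexI[of _ "d - k"]) auto
          thus ?thesis using k by (simp add: AB.A.E_newton[of k "flip d th" n] AB.A.E_simps)
        qed
      qed
      thus ?thesis by (simp add: e_def AB.B.E_simps)
    qed
    \<comment> \<open>both sides come from monic polynomials of degree \<open>d\<close>, whose difference cannot reach \<open>F d V\<close>\<close>
    have e_diag: "e (Suc i) (d - Suc i) = e i (d - i)"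
    proof -
      let ?w = "?N th (d - Suc i) v0"
      have "d - i = Suc (d - Suc i)" using i by simp
      hence "?N th (d - i) v0 = A ?w - th (d - Suc i) *s ?w" by simp
      moreover have "?eta (Suc i) ?w = ?eta i (A ?w - th (d - i) *s ?w)"
        by (simp add: AB.A.newton_linear AB.A.diag_newton)
      moreover have "F d (?eta i ?w) = 0" using e_low[of i "d - Suc i"] i by (simp add: e_def)
      ultimately show ?thesis by (simp add: e_def AB.A.newton_linear AB.B.E_simps del: newton.simps)
    qed
    have basis: "F d (?eta (Suc i) (B x - th' (d - Suc i) *s x)) = ph (d - i) *s F d (?eta i x)"
      if x: "x = ?N th j v0" and j: "j \<le> d" for x j
    proof (cases j)
      case 0
      have "B x = th' 0 *s x" using v0(1) AB.B.eigenvector_iff[of 0 v0] x 0 by simp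
      hence "F d (?eta (Suc i) (B x - th' (d - Suc i) *s x)) = (th' 0 - th' (d - Suc i)) *s e (Suc i) 0"
        using x 0 by (simp add: e_def AB.A.newton_linear AB.B.E_simps AB.A.scale_left_diff_distrib del: newton.simps(2))
      moreover have "th' 0 = th' (d - Suc i) \<or> e (Suc i) 0 = 0"
        using e_low[of "Suc i" 0] i by (cases "Suc i = d") auto
      ultimately show ?thesis using e_low[of i 0] i x 0 by (auto simp: e_def)
    next
      case (Suc l)
      have "B x = th' j *s x + ph j *s ?N th l v0"
        using ph v0(1) Suc j x unfolding split_sequence_def by (simp add: algebra_simps del: newton.simps)
      hence *: "F d (?eta (Suc i) (B x - th' (d - Suc i) *s x))
          = (th' j - th' (d - Suc i)) *s e (Suc i) j + ph j *s e (Suc i) l"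
        using x by (simp add: e_def AB.A.newton_linear AB.B.E_simps algebra_simps del: newton.simps)
      have **: "(th' j - th' (d - Suc i)) *s e (Suc i) j = 0"
      proof (cases "j = d - Suc i")
        case False
        hence "Suc i + j < d \<or> d < Suc i + j" using i by linarith
        hence "e (Suc i) j = 0" using e_low[of "Suc i" j] e_high[of "Suc i" j] i j by auto
        thus ?thesis by simp
      qed simp
      show ?thesis
      proof (cases "j = d - i")
        case True
        hence "l = d - Suc i" using Suc by simp
        thus ?thesis using * ** e_diag True x by (simp add: e_def)
      next
        case False
        hence "i + j < d \<or> d < i + j" using i by linarith
        hence "e (Suc i) l = 0" "e i j = 0"
          using e_low[of "Suc i" l] e_high[of "Suc i" l] e_low[of i j] e_high[of i j] i j Suc by auto
        thus ?thesis using * ** x by (simp add: e_def)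
      qed
    qed
    have row: "F d (?eta (Suc i) (B x - th' (d - Suc i) *s x)) = ph (d - i) *s F d (?eta i x)" for x
    proof -
      obtain b where b: "x = (\<Sum>k\<le>d. b k *s ?N th k v0)" using AB.newton_span_all[OF v0] by blast
      have "F d (?eta (Suc i) (B x - th' (d - Suc i) *s x))
          = (\<Sum>k\<le>d. b k *s F d (?eta (Suc i) (B (?N th k v0) - th' (d - Suc i) *s ?N th k v0)))"
        unfolding b
        by (simp add: AB.B.diag_simps AB.A.newton_linear AB.B.E_simps AB.A.scale_sum_right sum_subtractf
            AB.A.scale_right_diff_distrib AB.A.scale_left_commute mult.commute del: newton.simps)
      also have "\<dots> = (\<Sum>k\<le>d. b k *s ph (d - i) *s F d (?eta i (?N th k v0)))"
        by (intro sum.cong refl arg_cong[of _ _ "sc (b _)"] basis) auto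
      also have "\<dots> = ph (d - i) *s F d (?eta i x)"
        unfolding b by (simp add: AB.A.newton_linear AB.B.E_simps AB.A.scale_sum_right mult.commute)
      finally show ?thesis .
    qed
    have comm: "?eta (Suc i) (B v - th' (d - Suc i) *s v) = (th' d - th' (d - Suc i)) *s ?eta (Suc i) v"
      using v AB.B.eigenvector_iff[of d v]
      by (simp add: AB.A.newton_linear AB.A.scale_left_diff_distrib del: newton.simps)
    have "ph (d - i) *s F d (?eta i v) = F d (B (?eta (Suc i) v) - th' (d - Suc i) *s ?eta (Suc i) v)"
      unfolding row[of v, symmetric] comm
      by (simp add: AB.B.E_simps AB.B.E_diag AB.A.scale_left_diff_distrib del: newton.simps)
    also have "\<dots> = c *s F d (?eta i v)" unfolding c by (simp add: AB.B.E_simps)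
    finally have "ph (d - i) = c"
      using fl.F_0_newton_nonzero[OF v False, of i] i unfolding diag_op_flip by simp
    thus ?thesis using c by simp
  qed (simp add: AB.A.newton_linear AB.A.diag_zero AB.B.diag_zero del: newton.simps)
qed

end

section \<open>The switching element on the split bases\<close>
lemma newton_cong: "(\<And>k. k < n \<Longrightarrow> t k = t' k) \<Longrightarrow> newton sc T t n v = newton sc T t' n v"
  by (induction n) simp_all

text \<open>The coefficient of the \<open>r\<close>th idempotent in the switching element, \<open>ph\<close> and \<open>ps\<close> being the split sequences.\<close>
definition switch_coeff :: "nat \<Rightarrow> (nat \<Rightarrow> 'k::field) \<Rightarrow> (nat \<Rightarrow> 'k) \<Rightarrow> nat \<Rightarrow> 'k" where
  "switch_coeff d ph ps r = (\<Prod>j\<in>{d - r + 1..d}. ps j) / (\<Prod>j\<in>{1..r}. ph j)"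

lemma switch_coeff_0 [simp]: "switch_coeff d ph ps 0 = 1"
  by (simp add: switch_coeff_def)

lemma switch_coeff_Suc:
  assumes "r < d"
  shows "switch_coeff d ph ps (Suc r) = switch_coeff d ph ps r * (ps (d - r) / ph (Suc r))"
proof -
  have "{d - Suc r + 1..d} = insert (d - r) {d - r + 1..d}" using assms by auto
  thus ?thesis by (simp add: switch_coeff_def)
qed

lemma switch_coeff_nonzero:
  assumes "r \<le> d" "\<And>j. j \<in> {1..d} \<Longrightarrow> ph j \<noteq> 0" "\<And>j. j \<in> {1..d} \<Longrightarrow> ps j \<noteq> 0"
  shows "switch_coeff d ph ps r \<noteq> 0"
  using assms by (auto simp: switch_coeff_def)

context leonard begin

text \<open>
  The case of \<open>split_sequence_reverse\<close> in which the order of the \<open>E i\<close> is restored by a second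
  reversal; the two orders agree on indices up to \<open>d\<close>, and only those enter.
\<close>
lemma split_sequence_flip_F:
  assumes "split_sequence sc d (flip d E) (flip d th) F th' ps"
  shows "split_sequence sc d E th (flip d F) (flip d th') (\<lambda>i. ps (Suc d - i))"
proof -
  interpret fl: leonard sc d "flip d E" "flip d th" F th' by (rule flip_E)
  have A: "diag_op sc d (\<lambda>i. E (d - (d - i))) (\<lambda>i. th (d - (d - i))) = A"
    using diag_op_flip[of sc d "flip d E" "flip d th"] diag_op_flip[of sc d E th] by simp
  have N: "newton sc A (\<lambda>i. th (d - (d - i))) n v = newton sc A th n v" if "n \<le> d" for n v
    by (rule newton_cong) (use that in auto)
  show ?thesis
    using fl.split_sequence_reverse[OF assms] unfolding split_sequence_def A
    by (auto simp: N simp del: newton.simps)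
qed

text \<open>
  Let \<open>w \<noteq> 0\<close> lie in \<open>F d V\<close> and write \<open>E r w = \<sigma>\<^sub>r E r v\<close>.  Taking the \<open>E r\<close>-part of the lowering relations
  for \<open>v\<close> and for \<open>w\<close> turns both into relations between \<open>E r\<close>- and \<open>E (r + 1)\<close>-parts, and their
  comparison yields \<open>\<sigma>\<^bsub>r + 1\<^esub> ph\<^bsub>r + 1\<^esub> = ps\<^bsub>d - r\<^esub> \<sigma>\<^sub>r\<close>.  This is the recursion of the switching
  coefficients, so \<open>S v\<close> is a multiple of \<open>w\<close>.
\<close>
lemma switching:
  assumes ph: "split_sequence sc d E th F th' ph"
    and ps: "split_sequence sc d (flip d E) (flip d th) F th' ps"
    and v: "F 0 v = v"
  shows "F d (diag_op sc d E (switch_coeff d ph ps) v) = diag_op sc d E (switch_coeff d ph ps) v"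
proof (cases "v = 0")
  case False
  let ?N = "newton sc A th"
  let ?s = "switch_coeff d ph ps"
  interpret fl: leonard sc d E th "flip d F" "flip d th'" by (rule flip_F)
  note ps' = split_sequence_flip_F[OF ps]
  obtain w where w: "F d w = w" "w \<noteq> 0" using AB.B.eigenvector_exists[of d] by auto
  have "\<exists>c. E r w = c *s E r v" if "r \<le> d" for r
    using AB.A.E_line[OF that AB.E_nonzero[OF v False that]] .
  then obtain \<sigma> where \<sigma>: "\<And>r. r \<le> d \<Longrightarrow> E r w = \<sigma> r *s E r v" by metis
  have E_split: "(\<Prod>k<Suc r. th (Suc r) - th k) *s E r (B (E (Suc r) x))
        = c *s (\<Prod>k<r. th r - th k) *s E r x"
    if r: "r < d" and x: "B (?N (Suc r) x) - b *s ?N (Suc r) x = c *s ?N r x" for r x b c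
  proof -
    have "E r (B (?N (Suc r) x)) = E r (B (E (Suc r) (?N (Suc r) x)))"
    proof (rule BA.F_A_single)
      fix j assume "j \<le> d" "j \<noteq> Suc r" "j \<le> r + 1" "r \<le> j + 1"
      thus "E j (?N (Suc r) x) = 0" using newton_low_zero[of j "Suc r" x] r by simp
    qed (use r in auto)
    moreover have "E r (?N (Suc r) x) = 0" using newton_low_zero[of r "Suc r" x] r by simp
    ultimately have "E r (B (E (Suc r) (?N (Suc r) x))) = c *s E r (?N r x)"
      using arg_cong[OF x, of "E r"] r by (simp add: AB.A.E_simps del: newton.simps)
    thus ?thesis using r by (simp add: AB.A.E_newton AB.A.E_simps AB.B.diag_scale del: newton.simps)
  qed
  have step: "\<sigma> (Suc r) * ph (Suc r) = ps (d - r) * \<sigma> r" if r: "r < d" for r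
  proof -
    let ?p = "\<Prod>k<r. th r - th k"
    let ?q = "\<Prod>k<Suc r. th (Suc r) - th k"
    have pv: "?q *s E r (B (E (Suc r) v)) = ph (Suc r) *s ?p *s E r v"
      by (rule E_split[OF r, where b = "th' (Suc r)"]) (use ph v r in \<open>simp add: split_sequence_def del: newton.simps\<close>)
    have "?q *s E r (B (E (Suc r) w)) = ps (d - r) *s ?p *s E r w"
      by (rule E_split[OF r, where b = "th' (d - Suc r)"]) (use ps' w r in \<open>simp add: split_sequence_def diag_op_flip del: newton.simps\<close>)
    hence "\<sigma> (Suc r) *s (?q *s E r (B (E (Suc r) v))) = ps (d - r) *s ?p *s \<sigma> r *s E r v"
      using r \<sigma>[of r] \<sigma>[of "Suc r"] by (simp add: AB.A.E_simps AB.B.diag_scale mult.commute)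
    hence "(\<sigma> (Suc r) * ph (Suc r) * ?p) *s E r v = (ps (d - r) * \<sigma> r * ?p) *s E r v"
      unfolding pv by (simp add: ac_simps)
    hence "\<sigma> (Suc r) * ph (Suc r) * ?p = ps (d - r) * \<sigma> r * ?p"
      using AB.E_nonzero[OF v False, of r] r by (simp only: AB.A.scale_cancel_right) auto
    moreover have "?p \<noteq> 0" using r by (auto simp: AB.A.th_eq)
    ultimately show ?thesis by simp
  qed
  have \<sigma>_eq: "\<sigma> r = \<sigma> 0 * ?s r" if "r \<le> d" for r
    using that
  proof (induction r)
    case (Suc r)
    have "ph (Suc r) \<noteq> 0" using split_sequence_nonzero[OF ph, of "Suc r"] Suc.prems by simp
    thus ?case using Suc step[of r] by (simp add: switch_coeff_Suc field_simps)
  qed simp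
  have w_eq: "w = \<sigma> 0 *s diag_op sc d E ?s v"
  proof (rule AB.A.E_ext)
    fix r assume r: "r \<le> d"
    thus "E r w = E r (\<sigma> 0 *s diag_op sc d E ?s v)"
      using \<sigma>[OF r] \<sigma>_eq[OF r] by (simp add: AB.A.E_simps AB.A.E_diag)
  qed
  hence "\<sigma> 0 \<noteq> 0" using w(2) by auto
  moreover have "\<sigma> 0 *s F d (diag_op sc d E ?s v) = \<sigma> 0 *s diag_op sc d E ?s v"
    using w(1) unfolding w_eq by (simp add: AB.B.E_simps)
  ultimately show ?thesis by simp
qed (simp add: AB.A.diag_zero AB.B.E_simps)

text \<open>
  The subspace \<open>E 0 V + \<cdots> + E m V\<close> consists of the vectors \<open>p(B) z\<close> with \<open>z\<close> in \<open>E 0 V\<close> and \<open>p\<close> of degree at most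
  \<open>m\<close>.  An operator that commutes with \<open>B\<close> and maps \<open>E 0 V\<close> to \<open>E d V\<close> therefore maps it to
  \<open>E d V + \<cdots> + E (d - m) V\<close>.
\<close>
lemma swap_filtration:
  assumes swap: "\<And>z. E 0 z = z \<Longrightarrow> E d (diag_op sc d F g z) = diag_op sc d F g z"
    and x: "\<And>j. \<lbrakk>j \<le> d; m < j\<rbrakk> \<Longrightarrow> E j x = 0" and m: "m \<le> d" and j: "j < d - m"
  shows "E j (diag_op sc d F g x) = 0"
proof -
  let ?G = "diag_op sc d F g"
  interpret fl: tridiagonal_action sc d F th' "flip d E" "flip d th" by (rule BA.flip_F)
  obtain z where z: "E 0 z = z" "z \<noteq> 0" using AB.A.eigenvector_exists[of 0] by auto
  obtain c where c: "x = (\<Sum>k\<le>m. c k *s newton sc B th' k z)"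
    using BA.newton_span[OF z m x] by blast
  have "E j (newton sc B th' k (?G z)) = 0" if "k \<le> m" for k
    using fl.newton_F_zero[of "?G z" "d - j" k th'] swap[OF z(1)] j that by simp
  thus ?thesis
    unfolding c using j
    by (simp add: AB.B.diag_sum AB.B.diag_scale AB.B.diag_newton AB.A.E_simps)
qed

text \<open>
  Such an operator carries \<open>[0*0]\<close> to \<open>[0*D]\<close>, so \<open>\<eta> i v\<close> goes to a multiple of \<open>\<tau> i v\<close>.  It commutes
  with \<open>B - th' (i + 1)\<close>, which lowers \<open>\<eta> (i + 1) v\<close> with scalar \<open>ps (i + 1)\<close> and \<open>\<tau> (i + 1) v\<close> with scalar \<open>ph (i + 1)\<close>;
  this determines the multiple recursively.
\<close>
lemma swap_newton:
  assumes ph: "split_sequence sc d E th F th' ph"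
    and ps: "split_sequence sc d (flip d E) (flip d th) F th' ps"
    and swap: "\<And>z. E 0 z = z \<Longrightarrow> E d (diag_op sc d F g z) = diag_op sc d F g z"
    and v: "F 0 v = v" and i: "i \<le> d"
  shows "diag_op sc d F g (newton sc A (flip d th) i v)
       = (g 0 * (\<Prod>j\<in>{1..i}. ps j / ph j)) *s newton sc A th i v"
proof (cases "v = 0")
  case False
  let ?G = "diag_op sc d F g"
  let ?tau = "newton sc A th" and ?eta = "newton sc A (flip d th)"
  interpret fl: leonard sc d "flip d E" "flip d th" F th' by (rule flip_E)
  have ex: "\<exists>c. ?G (?eta k v) = c *s ?tau k v" if k: "k \<le> d" for k
  proof (rule AB.component[OF v False k])
    fix j assume "j \<le> d" "k < j"
    thus "F j (?G (?eta k v)) = 0" by (simp add: AB.B.E_diag AB.newton_F_zero[OF v])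
  next
    fix j assume j: "j < k"
    show "E j (?G (?eta k v)) = 0"
    proof (rule swap_filtration[OF swap])
      fix l assume "l \<le> d" "d - k < l"
      thus "E l (?eta k v) = 0" using fl.newton_low_zero[of "d - l" k v] k by (simp add: diag_op_flip)
    qed (use j k in auto)
  qed
  show ?thesis
    using i
  proof (induction i)
    case 0
    have "?G v = g 0 *s v"
    proof (rule AB.B.E_ext)
      fix j assume "j \<le> d"
      thus "F j (?G v) = F j (g 0 *s v)"
        using AB.B.E_fixed[OF _ _ v, of j] by (simp add: AB.B.E_diag AB.B.E_simps)
    qed
    thus ?case by simp
  next
    case (Suc i)
    obtain c where c: "?G (?eta (Suc i) v) = c *s ?tau (Suc i) v" using ex Suc.prems by blast
    have "c *s (ph (Suc i) *s ?tau i v) = B (?G (?eta (Suc i) v)) - th' (Suc i) *s ?G (?eta (Suc i) v)"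
      using ph v Suc.prems unfolding c split_sequence_def
      by (simp add: AB.B.diag_scale AB.A.scale_right_diff_distrib[symmetric]
          AB.A.scale_left_commute[of "th' _"] del: newton.simps AB.A.scale_scale)
    also have "\<dots> = ?G (B (?eta (Suc i) v) - th' (Suc i) *s ?eta (Suc i) v)"
      by (simp add: AB.B.diag_diff AB.B.diag_scale AB.B.diag_commute[of th' g] del: newton.simps)
    also have "\<dots> = ?G (ps (Suc i) *s ?eta i v)"
      using ps v Suc.prems by (simp add: split_sequence_def diag_op_flip del: newton.simps)
    also have "\<dots> = ps (Suc i) *s (g 0 * (\<Prod>j\<in>{1..i}. ps j / ph j)) *s ?tau i v"
      using Suc by (simp add: AB.B.diag_scale del: newton.simps)
    finally have "c * ph (Suc i) = ps (Suc i) * (g 0 * (\<Prod>j\<in>{1..i}. ps j / ph j))"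
      using newton_nonzero[OF v False, of i th] Suc.prems by (simp del: newton.simps)
    moreover have "ph (Suc i) \<noteq> 0" using split_sequence_nonzero[OF ph, of "Suc i"] Suc.prems by simp
    ultimately have "c = g 0 * (\<Prod>j\<in>{1..Suc i}. ps j / ph j)" by (simp add: field_simps)
    thus ?case using c by simp
  qed
qed (simp add: AB.A.newton_linear AB.B.diag_zero)

end

text \<open>
  \<open>g\<close> stands for the coefficients of the dual switching element.  The computation depends on them only
  through the properties listed here.
\<close>
locale leonard_switching = leonard sc d E th F th'
  for sc :: "'k::field \<Rightarrow> 'v::ab_group_add \<Rightarrow> 'v" (infixr "*s" 75) and d E th F th' +
  fixes ph ps g :: "nat \<Rightarrow> 'k"
  assumes ph: "split_sequence sc d E th F th' ph"
    and ps: "split_sequence sc d (flip d E) (flip d th) F th' ps"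
    and g_0: "g 0 = 1" and g_nonzero: "r \<le> d \<Longrightarrow> g r \<noteq> 0"
    and g_swap: "E 0 z = z \<Longrightarrow> E d (diag_op sc d F g z) = diag_op sc d F g z"
begin

abbreviation "s \<equiv> switch_coeff d ph ps"
abbreviation "S \<equiv> diag_op sc d E s"
abbreviation "S_inv \<equiv> diag_op sc d E (\<lambda>r. inverse (s r))"
abbreviation "G \<equiv> diag_op sc d F g"
abbreviation "G_inv \<equiv> diag_op sc d F (\<lambda>r. inverse (g r))"
abbreviation "\<tau> \<equiv> newton sc A th"
abbreviation "\<eta> \<equiv> newton sc A (flip d th)"

definition \<alpha> :: "nat \<Rightarrow> 'k" where "\<alpha> i = (\<Prod>j\<in>{1..i}. ps j / ph j)"

lemma ph_nonzero: "j \<in> {1..d} \<Longrightarrow> ph j \<noteq> 0"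
  by (rule split_sequence_nonzero[OF ph])

lemma ps_nonzero: "j \<in> {1..d} \<Longrightarrow> ps j \<noteq> 0"
  by (rule leonard.split_sequence_nonzero[OF flip_E ps])

lemma \<alpha>_nonzero: "i \<le> d \<Longrightarrow> \<alpha> i \<noteq> 0"
  unfolding \<alpha>_def using ph_nonzero ps_nonzero by auto

lemma s_nonzero: "r \<le> d \<Longrightarrow> s r \<noteq> 0"
  by (rule switch_coeff_nonzero) (use ph_nonzero ps_nonzero in auto)

lemma S_inv_S: "S_inv (S x) = x"
  by (rule AB.A.E_ext) (simp add: AB.A.E_diag s_nonzero)

lemma G_inv_G: "G_inv (G x) = x"
  by (rule AB.B.E_ext) (simp add: AB.B.E_diag g_nonzero)

lemma G_eta: "\<lbrakk>F 0 v = v; i \<le> d\<rbrakk> \<Longrightarrow> G (\<eta> i v) = \<alpha> i *s \<tau> i v"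
  using swap_newton[OF ph ps g_swap] by (simp add: g_0 \<alpha>_def)

text \<open>
  Applied to the system with the \<open>F i\<close> in reverse order, lemma \<open>swap_newton\<close> gives the multiple up to the
  unknown factor \<open>g d\<close>.  That factor is found at \<open>i = d\<close>, where \<open>\<eta> d\<close> and \<open>\<tau> d\<close> are multiples of \<open>E 0\<close> and \<open>E d\<close>:
  since \<open>S\<close> acts there as \<open>s 0 = 1\<close> and \<open>s d = \<alpha> d\<close>, the multiple for \<open>S v\<close> is \<open>1\<close>.
\<close>
lemma G_eta_S:
  assumes v: "F 0 v = v" and i: "i \<le> d"
  shows "G (\<eta> i (S v)) = \<alpha> (d - i) *s \<tau> i (S v)"
proof (cases "v = 0")
  case False
  interpret fl: leonard sc d E th "flip d F" "flip d th'" by (rule flip_F)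
  interpret fe: leonard sc d "flip d E" "flip d th" F th' by (rule flip_E)
  have w: "F d (S v) = S v" by (rule switching[OF ph ps v])
  define \<beta> where "\<beta> k = g d * (\<Prod>j\<in>{1..k}. ph (Suc d - j) / ps (Suc d - j))" for k
  have G: "G (\<eta> k (S v)) = \<beta> k *s \<tau> k (S v)" if k: "k \<le> d" for k
    using fl.swap_newton[OF split_sequence_flip_F[OF ps] split_sequence_reverse[OF ph], of "flip d g" "S v" k]
      g_swap w k unfolding diag_op_flip \<beta>_def by simp
  have wnz: "S v \<noteq> 0" using False S_inv_S[of v] by (auto simp: AB.A.diag_zero)
  have "\<eta> d (S v) = \<eta> d v"
  proof (rule AB.A.E_ext)
    fix j assume j: "j \<le> d"
    show "E j (\<eta> d (S v)) = E j (\<eta> d v)"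
    proof (cases "j = 0")
      case False
      hence "(\<Prod>k<d. th j - th (d - k)) = 0" using j by (intro prod_zero bexI[of _ "d - j"]) auto
      thus ?thesis using j by (simp add: AB.A.E_newton)
    qed (simp add: AB.A.E_newton AB.A.E_diag)
  qed
  moreover have "\<tau> d (S v) = s d *s \<tau> d v"
  proof (rule AB.A.E_ext)
    fix j assume j: "j \<le> d"
    show "E j (\<tau> d (S v)) = E j (s d *s \<tau> d v)"
      using newton_low_zero[of j d v] newton_low_zero[of j d "S v"] j
      by (cases "j = d") (auto simp: AB.A.E_newton AB.A.E_simps AB.A.E_diag)
  qed
  moreover have "s d = \<alpha> d" by (simp add: switch_coeff_def \<alpha>_def prod_dividef)
  ultimately have "\<beta> d *s \<tau> d (S v) = \<tau> d (S v)"
    using G[of d] G_eta[OF v, of d] by simp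
  moreover have "\<tau> d (S v) \<noteq> 0" by (rule fl.newton_nonzero) (use w wnz in auto)
  ultimately have \<beta>d: "\<beta> d = 1" using AB.A.scale_cancel_right[of "\<beta> d" "\<tau> d (S v)" 1] by simp
  have "\<beta> k = \<alpha> (d - k)" if "k \<le> d" for k
    using that
  proof (induction k rule: inc_induct)
    case (step k)
    have "d - k = Suc (d - Suc k)" "Suc d - Suc k = d - k" using step by auto
    moreover have "ph (d - k) \<noteq> 0" "ps (d - k) \<noteq> 0" using ph_nonzero ps_nonzero step by auto
    ultimately show ?case using step(3) by (auto simp: \<beta>_def \<alpha>_def field_simps)
  qed (simp add: \<beta>d \<alpha>_def)
  thus ?thesis using G i by simp
qed (simp add: AB.A.diag_zero AB.B.diag_zero AB.A.newton_linear)

lemma S_newton: "S (newton sc A t i v) = newton sc A t i (S v)"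
  by (rule AB.A.diag_newton)

lemma S_inv_newton: "S_inv (newton sc A t i (S v)) = newton sc A t i v"
  by (simp add: AB.A.diag_newton S_inv_S)

lemma G_inv_tau: "\<lbrakk>F 0 v = v; i \<le> d\<rbrakk> \<Longrightarrow> G_inv (\<tau> i v) = inverse (\<alpha> i) *s \<eta> i v"
  using arg_cong[OF G_eta[of v i], of "\<lambda>x. G_inv (inverse (\<alpha> i) *s x)"] \<alpha>_nonzero[of i]
  by (simp add: AB.B.diag_scale G_inv_G)

lemma G_inv_tau_S:
  "\<lbrakk>F 0 v = v; i \<le> d\<rbrakk> \<Longrightarrow> G_inv (\<tau> i (S v)) = inverse (\<alpha> (d - i)) *s \<eta> i (S v)"
  using arg_cong[OF G_eta_S[of v i], of "\<lambda>x. G_inv (inverse (\<alpha> (d - i)) *s x)"] \<alpha>_nonzero[of "d - i"]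
  by (simp add: AB.B.diag_scale G_inv_G)

lemmas cycle = S_newton S_inv_newton G_eta G_eta_S G_inv_tau G_inv_tau_S AB.A.diag_scale AB.B.diag_scale

lemma eigenvector_pair:
  obtains v where "F 0 v = v" "v \<noteq> 0" "F d (S v) = S v" "S v \<noteq> 0"
proof -
  obtain v where v: "F 0 v = v" "v \<noteq> 0" using AB.B.eigenvector_exists[of 0] by auto
  moreover from v have "S v \<noteq> 0" using S_inv_S[of v] by (auto simp: AB.A.diag_zero)
  ultimately show ?thesis using that switching[OF ph ps v(1)] by blast
qed

text \<open>
  In the following four lemmas \<open>x\<close> is a multiple of \<open>\<tau> i v\<close>, \<open>\<tau> i (S v)\<close>, \<open>\<eta> i v\<close> or \<open>\<eta> i (S v)\<close>, and the
  product moves it once around the square of these vectors.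
\<close>
lemma commutator_0'D:
  assumes "i \<le> d" "\<And>j. \<lbrakk>j \<le> d; i < j\<rbrakk> \<Longrightarrow> F j x = 0" "\<And>j. j < i \<Longrightarrow> E j x = 0"
  shows "G (S_inv (G_inv (S x))) = (\<alpha> i / \<alpha> (d - i)) *s x"
proof -
  obtain v where v: "F 0 v = v" "v \<noteq> 0" using eigenvector_pair by blast
  obtain c where "x = c *s \<tau> i v" using AB.component[OF v assms(1)] assms by blast
  thus ?thesis using v assms(1) by (simp add: cycle divide_inverse mult_ac del: newton.simps)
qed

lemma commutator_D'D:
  assumes "i \<le> d" "\<And>j. \<lbrakk>j \<le> d; i < j\<rbrakk> \<Longrightarrow> F (d - j) x = 0" "\<And>j. j < i \<Longrightarrow> E j x = 0"
  shows "G (S (G_inv (S_inv x))) = (\<alpha> (d - i) / \<alpha> i) *s x"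
proof -
  interpret fl: leonard sc d E th "flip d F" "flip d th'" by (rule flip_F)
  obtain v where v: "F 0 v = v" "F d (S v) = S v" "S v \<noteq> 0" using eigenvector_pair by blast
  obtain c where "x = c *s \<tau> i (S v)" using fl.AB.component[of "S v" i x] v assms by auto
  thus ?thesis using v assms(1) by (simp add: cycle divide_inverse mult_ac del: newton.simps)
qed

lemma commutator_0'0:
  assumes "i \<le> d" "\<And>j. \<lbrakk>j \<le> d; i < j\<rbrakk> \<Longrightarrow> F j x = 0" "\<And>j. j < i \<Longrightarrow> E (d - j) x = 0"
  shows "G_inv (S_inv (G (S x))) = (\<alpha> (d - i) / \<alpha> i) *s x"
proof -
  interpret fl: leonard sc d "flip d E" "flip d th" F th' by (rule flip_E)
  obtain v where v: "F 0 v = v" "v \<noteq> 0" using eigenvector_pair by blast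
  obtain c where "x = c *s \<eta> i v" using fl.AB.component[of v i x] v assms by (auto simp: diag_op_flip)
  thus ?thesis using v assms(1) by (simp add: cycle divide_inverse mult_ac del: newton.simps)
qed

lemma commutator_D'0:
  assumes "i \<le> d" "\<And>j. \<lbrakk>j \<le> d; i < j\<rbrakk> \<Longrightarrow> F (d - j) x = 0" "\<And>j. j < i \<Longrightarrow> E (d - j) x = 0"
  shows "G_inv (S (G (S_inv x))) = (\<alpha> i / \<alpha> (d - i)) *s x"
proof -
  interpret fl: leonard sc d "flip d E" "flip d th" "flip d F" "flip d th'"
    by (rule leonard.flip_F[OF flip_E])
  obtain v where v: "F 0 v = v" "F d (S v) = S v" "S v \<noteq> 0" using eigenvector_pair by blast
  obtain c where "x = c *s \<eta> i (S v)"
    using fl.AB.component[of "S v" i x] v assms by (auto simp: diag_op_flip)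
  thus ?thesis using v assms(1) by (simp add: cycle divide_inverse mult_ac del: newton.simps)
qed

end

section \<open>Primitive idempotents in a full matrix algebra\<close>
context full_matrix_algebra
begin

definition entry :: "'a \<Rightarrow> nat \<Rightarrow> nat \<Rightarrow> 'k" where "entry y a b = rep y $$ (a, b)"

lemma rep_carrier: "rep y \<in> carrier_mat (d + 1) (d + 1)"
  using rep_bij by (auto simp: bij_betw_def)

lemma rep_dim [simp]: "dim_row (rep y) = d + 1" "dim_col (rep y) = d + 1"
  using rep_carrier[of y] by auto

lemma entry_ext:
  assumes "\<And>a b. \<lbrakk>a \<le> d; b \<le> d\<rbrakk> \<Longrightarrow> entry y a b = entry z a b" shows "y = z"
proof -
  have "rep y = rep z" using assms by (intro eq_matI) (auto simp: entry_def less_Suc_eq_le)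
  thus ?thesis using rep_bij by (auto simp: bij_betw_def inj_on_def)
qed

lemma entry_exists: "\<exists>y. \<forall>a\<le>d. \<forall>b\<le>d. entry y a b = f a b"
proof -
  have "mat (d + 1) (d + 1) (\<lambda>(a, b). f a b) \<in> range rep"
    using rep_bij by (auto simp: bij_betw_def)
  then obtain y where "rep y = mat (d + 1) (d + 1) (\<lambda>(a, b). f a b)" by auto
  hence "\<forall>a\<le>d. \<forall>b\<le>d. entry y a b = f a b" by (simp add: entry_def)
  thus ?thesis by blast
qed

lemma entry_mult:
  assumes "a \<le> d" "b \<le> d" shows "entry (y * z) a b = (\<Sum>c\<le>d. entry y a c * entry z c b)"
  using assms by (auto simp: entry_def rep_mult scalar_prod_def less_Suc_eq_le atLeast0LessThan
      lessThan_Suc_atMost intro!: sum.cong)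

lemma entry_linear:
  assumes "a \<le> d" "b \<le> d"
  shows "entry (y + z) a b = entry y a b + entry z a b"
    and "entry (scale c y) a b = c * entry y a b"
    and "entry 1 a b = (if a = b then 1 else 0)"
  using assms by (auto simp: entry_def rep_add rep_scale rep_one less_Suc_eq_le)

lemma entry_zero: "\<lbrakk>a \<le> d; b \<le> d\<rbrakk> \<Longrightarrow> entry 0 a b = 0"
  using entry_linear(2)[of a b 0 0] by simp

lemma entry_sum: "\<lbrakk>a \<le> d; b \<le> d\<rbrakk> \<Longrightarrow> entry (sum f I) a b = (\<Sum>i\<in>I. entry (f i) a b)"
  by (induction I rule: infinite_finite_induct) (auto simp: entry_zero entry_linear)

text \<open>A matrix unit placed between a nonzero entry of \<open>y\<close> and one of \<open>z\<close> will do for \<open>u\<close>.\<close>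
lemma prime_algebra:
  fixes y z :: 'a
  assumes "y \<noteq> 0" "z \<noteq> 0" shows "\<exists>u. y * u * z \<noteq> 0"
proof -
  obtain a b where ab: "a \<le> d" "b \<le> d" "entry y a b \<noteq> 0"
    using entry_ext[of y 0] assms(1) by (auto simp: entry_zero)
  obtain c e where ce: "c \<le> d" "e \<le> d" "entry z c e \<noteq> 0"
    using entry_ext[of z 0] assms(2) by (auto simp: entry_zero)
  obtain u where u: "\<forall>k\<le>d. \<forall>l\<le>d. entry u k l = (if k = b \<and> l = c then 1 else 0)"
    using entry_exists[of "\<lambda>k l. if k = b \<and> l = c then 1 else 0"] by blast
  have "entry (y * u) a l = (if l = c then entry y a b else 0)" if "l \<le> d" for l
    using ab that u by (simp add: entry_mult if_distrib[of "\<lambda>x. _ * x"] cong: if_cong)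
  hence "entry (y * u * z) a e = entry y a b * entry z c e"
    using ab ce by (simp add: entry_mult[of a e] if_distrib[of "\<lambda>x. x * _"] cong: if_cong)
  hence "entry (y * u * z) a e \<noteq> 0" using ab ce by simp
  thus ?thesis using ab ce by (metis entry_zero)
qed

lemma rep_prod_eigenvector:
  assumes v: "v \<in> carrier_vec (d + 1)" "rep x *\<^sub>v v = t \<cdot>\<^sub>v v"
  shows "rep (\<Prod>j\<leftarrow>js. scale (c j) (x - scale (\<theta> j) 1)) *\<^sub>v v = (\<Prod>j\<leftarrow>js. c j * (t - \<theta> j)) \<cdot>\<^sub>v v"
proof (induction js)
  case Nil
  show ?case using v by (simp add: rep_one)
next
  case (Cons j js)
  let ?Q = "\<Prod>j\<leftarrow>js. scale (c j) (x - scale (\<theta> j) 1)" and ?q = "\<Prod>j\<leftarrow>js. c j * (t - \<theta> j)"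
  have "rep (x - scale (\<theta> j) 1) = rep x + (- \<theta> j) \<cdot>\<^sub>m 1\<^sub>m (d + 1)"
    using rep_add[of x "scale (- \<theta> j) 1"] rep_scale[of "- \<theta> j" 1] by (simp add: rep_one)
  hence "rep (x - scale (\<theta> j) 1) *\<^sub>v v = rep x *\<^sub>v v + ((- \<theta> j) \<cdot>\<^sub>m 1\<^sub>m (d + 1)) *\<^sub>v v"
    using add_mult_distrib_mat_vec[OF rep_carrier[of x] _ v(1)] by simp
  also have "((- \<theta> j) \<cdot>\<^sub>m 1\<^sub>m (d + 1)) *\<^sub>v v = (- \<theta> j) \<cdot>\<^sub>v v"
    using v(1) by auto
  finally have "rep (x - scale (\<theta> j) 1) *\<^sub>v v = rep x *\<^sub>v v + (- \<theta> j) \<cdot>\<^sub>v v" .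
  hence 1: "rep (x - scale (\<theta> j) 1) *\<^sub>v v = (t - \<theta> j) \<cdot>\<^sub>v v"
    unfolding v(2) using v(1) by (auto simp: algebra_simps)
  have "rep (scale (c j) (x - scale (\<theta> j) 1) * ?Q) *\<^sub>v v
      = rep (scale (c j) (x - scale (\<theta> j) 1)) *\<^sub>v (?q \<cdot>\<^sub>v v)"
    unfolding rep_mult Cons.IH[symmetric]
    by (rule assoc_mult_mat_vec[OF rep_carrier rep_carrier v(1)])
  also have "\<dots> = ?q \<cdot>\<^sub>v (c j \<cdot>\<^sub>v (rep (x - scale (\<theta> j) 1) *\<^sub>v v))"
    using v(1) rep_carrier by (auto simp: rep_scale mult_mat_vec)
  also have "\<dots> = (\<Prod>j\<leftarrow>j # js. c j * (t - \<theta> j)) \<cdot>\<^sub>v v"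
    unfolding 1 by (simp add: smult_smult_assoc ac_simps)
  finally show ?case by simp
qed

text \<open>
  Eigenvectors for the \<open>d + 1\<close> eigenvalues form the columns of a matrix \<open>P\<close>.  The product that defines
  \<open>E i\<close> fixes the \<open>i\<close>th column and kills the others.  Hence \<open>P c = 0\<close> implies
  \<open>c\<^sub>i = 0\<close> for every \<open>i\<close>, so \<open>P\<close> is invertible, and \<open>E i\<close> is the \<open>i\<close>th column of \<open>P\<close> times the \<open>i\<close>th row
  of its inverse.
\<close>
lemma idempotents_rank_one:
  assumes "idempotents_for d scale rep x E \<theta>"
  obtains p r where
    "\<And>i a b. \<lbrakk>i \<le> d; a \<le> d; b \<le> d\<rbrakk> \<Longrightarrow> entry (E i) a b = p a i * r i b"
    "\<And>i j. \<lbrakk>i \<le> d; j \<le> d\<rbrakk> \<Longrightarrow> (\<Sum>a\<le>d. r i a * p a j) = (if i = j then 1 else 0)"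
    "\<And>a b. \<lbrakk>a \<le> d; b \<le> d\<rbrakk> \<Longrightarrow> (\<Sum>i\<le>d. p a i * r i b) = (if a = b then 1 else 0)"
    "\<And>i a. \<lbrakk>i \<le> d; a \<le> d\<rbrakk> \<Longrightarrow> (\<Sum>b\<le>d. entry x a b * p b i) = \<theta> i * p a i"
proof -
  let ?n = "d + 1"
  have bij: "bij_betw \<theta> {..d} {t. eigenvalue (rep x) t}"
    and E: "\<And>i. i \<le> d \<Longrightarrow> E i = primitive_idempotent d scale x \<theta> i"
    using assms by (auto simp: idempotents_for_def eigenvalue_ordering_def)
  have inj: "\<theta> i = \<theta> j \<longleftrightarrow> i = j" if "i \<le> d" "j \<le> d" for i j
    using bij that by (auto simp: bij_betw_def inj_on_def)
  have "\<exists>v. eigenvector (rep x) v (\<theta> i)" if "i \<le> d" for i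
    using bij that by (auto simp: bij_betw_def eigenvalue_def)
  then obtain v where "\<And>i. i \<le> d \<Longrightarrow> eigenvector (rep x) (v i) (\<theta> i)" by metis
  hence v: "\<And>i. i \<le> d \<Longrightarrow> v i \<in> carrier_vec ?n" "\<And>i. i \<le> d \<Longrightarrow> v i \<noteq> 0\<^sub>v ?n"
    "\<And>i. i \<le> d \<Longrightarrow> rep x *\<^sub>v v i = \<theta> i \<cdot>\<^sub>v v i"
    by (auto simp: eigenvector_def)
  have Ev: "rep (E i) *\<^sub>v v j = (if i = j then 1 else 0) \<cdot>\<^sub>v v j" if "i \<le> d" "j \<le> d" for i j
  proof -
    let ?js = "filter (\<lambda>j. j \<noteq> i) [0..<Suc d]"
    have "rep (E i) *\<^sub>v v j = (\<Prod>k\<leftarrow>?js. 1 / (\<theta> i - \<theta> k) * (\<theta> j - \<theta> k)) \<cdot>\<^sub>v v j"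
      unfolding E[OF that(1)] primitive_idempotent_def
      by (rule rep_prod_eigenvector) (use v that in auto)
    also have "(\<Prod>k\<leftarrow>?js. 1 / (\<theta> i - \<theta> k) * (\<theta> j - \<theta> k)) = (if i = j then 1 else 0)"
    proof (cases "i = j")
      case True
      have "1 / (\<theta> i - \<theta> k) * (\<theta> j - \<theta> k) = 1" if "k \<in> set ?js" for k
        using inj[of i k] \<open>i \<le> d\<close> that True by (auto simp del: upt_Suc)
      hence "map (\<lambda>k. 1 / (\<theta> i - \<theta> k) * (\<theta> j - \<theta> k)) ?js = map (\<lambda>_. 1) ?js"
        by (intro map_cong refl)
      thus ?thesis using True by (simp add: map_replicate_const)
    next
      case False
      hence "j \<in> set ?js" using that by auto
      thus ?thesis using False by (force simp: prod_list_zero_iff)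
    qed
    finally show ?thesis .
  qed
  define P where "P = mat ?n ?n (\<lambda>(a, j). v j $ a)"
  define D where "D i = mat ?n ?n (\<lambda>(a, b). if a = i \<and> b = i then 1 else 0 :: 'k)" for i :: nat
  have P: "P \<in> carrier_mat ?n ?n" and D: "D i \<in> carrier_mat ?n ?n" for i
    by (auto simp: P_def D_def)
  have colP: "col P j = v j" if "j \<le> d" for j
    using v(1)[OF that] that by (intro eq_vecI) (auto simp: P_def)
  have EP: "rep (E i) * P = P * D i" if i: "i \<le> d" for i
  proof (rule eq_matI)
    fix a j assume "a < dim_row (P * D i)" "j < dim_col (P * D i)"
    hence aj: "a \<le> d" "j \<le> d" by (auto simp: P_def D_def)
    have "(rep (E i) * P) $$ (a, j) = (rep (E i) *\<^sub>v v j) $ a"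
      using aj colP[of j] P by (auto simp: mult_mat_vec_def)
    also have "\<dots> = (if i = j then v j $ a else 0)"
      unfolding Ev[OF i aj(2)] using v(1)[OF aj(2)] aj by auto
    also have "\<dots> = (P * D i) $$ (a, j)"
      using aj i by (auto simp: P_def D_def scalar_prod_def if_distrib[of "\<lambda>x. _ * x"] cong: if_cong)
    finally show "(rep (E i) * P) $$ (a, j) = (P * D i) $$ (a, j)" .
  qed (auto simp: P_def D_def)
  have "det P \<noteq> 0"
  proof
    assume "det P = 0"
    then obtain c where c: "c \<in> carrier_vec ?n" "c \<noteq> 0\<^sub>v ?n" "P *\<^sub>v c = 0\<^sub>v ?n"
      using det_0_iff_vec_prod_zero_field[OF P] by blast
    have "c $ i = 0" if i: "i \<le> d" for i
    proof -
      have "P *\<^sub>v (D i *\<^sub>v c) = rep (E i) *\<^sub>v (P *\<^sub>v c)"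
        using EP[OF i] assoc_mult_mat_vec[OF P D c(1)] assoc_mult_mat_vec[OF rep_carrier P c(1)] by metis
      also have "\<dots> = 0\<^sub>v ?n" unfolding c(3) using rep_carrier by auto
      finally have 0: "P *\<^sub>v (D i *\<^sub>v c) = 0\<^sub>v ?n" .
      have Dc: "(D i *\<^sub>v c) $ b = (if b = i then c $ i else 0)" if "b \<le> d" for b
        using that i c(1) by (auto simp: D_def scalar_prod_def if_distrib[of "\<lambda>x. x * _"] cong: if_cong)
      have Ddim: "dim_vec (D i *\<^sub>v c) = d + 1" by (simp add: D_def)
      have "v i $ a * c $ i = 0" if a: "a \<le> d" for a
      proof -
        have "(P *\<^sub>v (D i *\<^sub>v c)) $ a = (\<Sum>b\<in>{0..<Suc d}. v b $ a * (D i *\<^sub>v c) $ b)"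
          using a Ddim by (simp add: P_def scalar_prod_def)
        also have "\<dots> = (\<Sum>b\<in>{0..<Suc d}. if b = i then v b $ a * c $ i else 0)"
          by (rule sum.cong) (auto simp: Dc)
        also have "\<dots> = v i $ a * c $ i" using i by simp
        finally show ?thesis using 0 a by simp
      qed
      moreover obtain a where "a \<le> d" "v i $ a \<noteq> 0"
      proof (rule ccontr)
        assume "\<not> thesis"
        hence "v i = 0\<^sub>v ?n" using that v(1)[OF i] by (intro eq_vecI) (auto simp: less_Suc_eq_le)
        thus False using v(2)[OF i] by simp
      qed
      ultimately show ?thesis by auto
    qed
    thus False using c(1,2) by (metis eq_vecI carrier_vecD index_zero_vec less_Suc_eq_le Suc_eq_plus1)
  qed
  then obtain R where R: "R \<in> carrier_mat ?n ?n" "P * R = 1\<^sub>m ?n" "R * P = 1\<^sub>m ?n"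
    using det_non_zero_imp_unit[OF P, of "()"]
    by (auto simp: Units_def ring_mat_simps)
  have sum_eq: "(\<Sum>c\<le>d. f c) = (\<Sum>c = 0..<Suc d. f c)" for f :: "nat \<Rightarrow> 'k"
    by (simp only: atLeast0LessThan lessThan_Suc_atMost)
  show ?thesis
  proof
    fix i a b assume i: "i \<le> d" and ab: "a \<le> d" "b \<le> d"
    have "rep (E i) = rep (E i) * (P * R)" using R rep_carrier[of "E i"] by simp
    also have "\<dots> = rep (E i) * P * R" using assoc_mult_mat[OF rep_carrier P R(1)] by simp
    finally have "rep (E i) = P * D i * R" unfolding EP[OF i] .
    moreover have "(M * R) $$ (a, b) = (\<Sum>c = 0..<Suc d. M $$ (a, c) * R $$ (c, b))"
      if "M \<in> carrier_mat ?n ?n" for M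
      using that ab R(1) by (simp add: scalar_prod_def del: sum.op_ivl_Suc)
    ultimately have "entry (E i) a b = (\<Sum>c = 0..<Suc d. (P * D i) $$ (a, c) * R $$ (c, b))"
      using mult_carrier_mat[OF P D[of i]] by (simp only: entry_def)
    also have "\<dots> = (\<Sum>c = 0..<Suc d. if c = i then P $$ (a, c) * R $$ (c, b) else 0)"
      using ab i by (intro sum.cong refl)
        (auto simp: P_def D_def scalar_prod_def if_distrib[of "\<lambda>x. _ * x"] cong: if_cong)
    also have "\<dots> = P $$ (a, i) * R $$ (i, b)" using i by simp
    finally show "entry (E i) a b = P $$ (a, i) * R $$ (i, b)" .
  next
    fix i j assume "i \<le> d" "j \<le> d"
    thus "(\<Sum>a\<le>d. R $$ (i, a) * P $$ (a, j)) = (if i = j then 1 else 0)"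
      using arg_cong[OF R(3), of "\<lambda>M. M $$ (i, j)"] R(1) P by (simp add: scalar_prod_def sum_eq)
  next
    fix a b assume "a \<le> d" "b \<le> d"
    thus "(\<Sum>i\<le>d. P $$ (a, i) * R $$ (i, b)) = (if a = b then 1 else 0)"
      using arg_cong[OF R(2), of "\<lambda>M. M $$ (a, b)"] R(1) P by (simp add: scalar_prod_def sum_eq)
  next
    fix i a assume ia: "i \<le> d" "a \<le> d"
    have "(\<Sum>b\<le>d. entry x a b * P $$ (b, i)) = (rep x *\<^sub>v v i) $ a"
      using ia v(1)[OF ia(1)] by (simp add: entry_def P_def scalar_prod_def sum_eq)
    also have "\<dots> = \<theta> i * P $$ (a, i)"
      using ia v(1)[OF ia(1)] by (simp add: v(3) P_def)
    finally show "(\<Sum>b\<le>d. entry x a b * P $$ (b, i)) = \<theta> i * P $$ (a, i)" .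
  qed
qed

lemma
  assumes "idempotents_for d scale rep x E \<theta>"
  shows idempotents_mult: "\<And>i j. \<lbrakk>i \<le> d; j \<le> d\<rbrakk> \<Longrightarrow> E i * E j = (if i = j then E j else 0)"
    and idempotents_sum: "(\<Sum>i\<le>d. E i) = 1"
    and idempotents_eigen: "\<And>i. i \<le> d \<Longrightarrow> x * E i = scale (\<theta> i) (E i)"
    and idempotents_nonzero: "\<And>i. i \<le> d \<Longrightarrow> E i \<noteq> 0"
    and idempotents_trace: "\<And>i y. i \<le> d \<Longrightarrow> E i * y * E i = scale (mat_trace (rep (y * E i))) (E i)"
proof -
  obtain p r where E: "\<And>i a b. \<lbrakk>i \<le> d; a \<le> d; b \<le> d\<rbrakk> \<Longrightarrow> entry (E i) a b = p a i * r i b"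
    and rp: "\<And>i j. \<lbrakk>i \<le> d; j \<le> d\<rbrakk> \<Longrightarrow> (\<Sum>a\<le>d. r i a * p a j) = (if i = j then 1 else 0)"
    and pr: "\<And>a b. \<lbrakk>a \<le> d; b \<le> d\<rbrakk> \<Longrightarrow> (\<Sum>i\<le>d. p a i * r i b) = (if a = b then 1 else 0)"
    and xp: "\<And>i a. \<lbrakk>i \<le> d; a \<le> d\<rbrakk> \<Longrightarrow> (\<Sum>b\<le>d. entry x a b * p b i) = \<theta> i * p a i"
    using idempotents_rank_one[OF assms] by blast
  show "E i * E j = (if i = j then E j else 0)" if ij: "i \<le> d" "j \<le> d" for i j
  proof (rule entry_ext)
    fix a b assume ab: "a \<le> d" "b \<le> d"
    have "entry (E i * E j) a b = (\<Sum>c\<le>d. p a i * (r i c * p c j) * r j b)"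
      using ij ab by (simp add: entry_mult E ac_simps)
    also have "\<dots> = p a i * (\<Sum>c\<le>d. r i c * p c j) * r j b"
      by (simp add: sum_distrib_left sum_distrib_right)
    finally show "entry (E i * E j) a b = entry (if i = j then E j else 0) a b"
      using ij ab by (simp add: rp E entry_zero)
  qed
  show "(\<Sum>i\<le>d. E i) = 1"
    by (rule entry_ext) (simp add: entry_sum entry_linear E pr)
  show "x * E i = scale (\<theta> i) (E i)" if i: "i \<le> d" for i
  proof (rule entry_ext)
    fix a b assume ab: "a \<le> d" "b \<le> d"
    have "entry (x * E i) a b = (\<Sum>c\<le>d. entry x a c * p c i) * r i b"
      using i ab by (simp add: entry_mult E sum_distrib_right mult.assoc)
    thus "entry (x * E i) a b = entry (scale (\<theta> i) (E i)) a b"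
      using i ab by (simp add: xp E entry_linear)
  qed
  show "E i \<noteq> 0" if i: "i \<le> d" for i
  proof
    assume "E i = 0"
    hence 0: "p a i * r i b = 0" if "a \<le> d" "b \<le> d" for a b
      using E[OF i that] that by (simp add: entry_zero)
    have "(\<Sum>a\<le>d. r i a * p a i) = 0" by (intro sum.neutral) (auto simp: 0 mult.commute)
    thus False using rp[OF i i] by simp
  qed
  show "E i * y * E i = scale (mat_trace (rep (y * E i))) (E i)" if i: "i \<le> d" for i y
  proof (rule entry_ext)
    fix a b assume ab: "a \<le> d" "b \<le> d"
    have "mat_trace (rep (y * E i)) = (\<Sum>c\<le>d. entry (y * E i) c c)"
      by (simp add: mat_trace_def entry_def lessThan_Suc_atMost)
    also have "\<dots> = (\<Sum>c\<le>d. \<Sum>e\<le>d. entry y c e * p e i * r i c)"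
      using i by (simp add: entry_mult E ac_simps)
    finally have tr: "mat_trace (rep (y * E i)) = (\<Sum>c\<le>d. \<Sum>e\<le>d. entry y c e * p e i * r i c)" .
    have "entry (E i * y * E i) a b = (\<Sum>e\<le>d. (\<Sum>c\<le>d. p a i * r i c * entry y c e) * (p e i * r i b))"
      using i ab by (simp add: entry_mult E)
    also have "\<dots> = (\<Sum>e\<le>d. \<Sum>c\<le>d. entry y c e * p e i * r i c) * (p a i * r i b)"
      by (simp add: sum_distrib_left sum_distrib_right ac_simps)
    also have "\<dots> = entry (scale (mat_trace (rep (y * E i))) (E i)) a b"
      unfolding tr using i ab by (subst sum.swap) (simp add: E entry_linear)
    finally show "entry (E i * y * E i) a b = entry (scale (mat_trace (rep (y * E i))) (E i)) a b" .
  qed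
qed

end

section \<open>The simple module\<close>
lemma alg_inverse_eq: "\<lbrakk>x * y = 1; y * x = 1\<rbrakk> \<Longrightarrow> alg_inverse x = (y :: 'a::monoid_mult)"
  unfolding alg_inverse_def by (rule the_equality, simp) (metis mult.assoc mult_1_left mult_1_right)

locale matrix_algebra_module =
  full_matrix_algebra d scale rep + simple_left_module act
  for d :: nat and scale :: "'k::field \<Rightarrow> 'a::ring_1 \<Rightarrow> 'a" and rep :: "'a \<Rightarrow> 'k mat"
    and act :: "'a \<Rightarrow> 'v::ab_group_add \<Rightarrow> 'v"
begin

definition vscale :: "'k \<Rightarrow> 'v \<Rightarrow> 'v" where "vscale c v = act (scale c 1) v"

sublocale V: vector_space vscale
proof
  show "vscale a (x + y) = vscale a x + vscale a y" for a x y
    by (simp add: vscale_def act_add_right)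
  show "vscale (a + b) x = vscale a x + vscale b x" for a b x
    by (simp add: vscale_def scale_left_distrib act_add_left)
  show "vscale a (vscale b x) = vscale (a * b) x" for a b x
    by (simp add: vscale_def act_mult[symmetric] scale_mult_left)
  show "vscale 1 x = x" for x
    by (simp add: vscale_def act_one)
qed

lemma act_scale_left: "act (scale c y) v = vscale c (act y v)"
  by (simp add: vscale_def act_mult[symmetric] scale_mult_left)

lemma act_scale_right: "act y (vscale c v) = vscale c (act y v)"
  by (simp add: vscale_def act_mult[symmetric] scale_mult_left scale_mult_right)

lemma act_zero: "act 0 v = 0" "act y 0 = 0"
  using act_add_left[of 0 0 v] act_add_right[of y 0 0] by simp_all

lemma act_diff_left: "act (x - y) v = act x v - act y v"
  using act_add_left[of "x - y" y v] by (simp add: algebra_simps)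

lemma act_sum_left: "act (sum f I) v = (\<Sum>i\<in>I. act (f i) v)"
  by (induction I rule: infinite_finite_induct) (simp_all add: act_zero act_add_left)

lemma act_linear: "Vector_Spaces.linear vscale vscale (act y)"
  by unfold_locales (simp_all add: act_add_right act_scale_right)

text \<open>The orbit of a nonzero vector is a nonzero submodule.\<close>
lemma act_generates: "v \<noteq> 0 \<Longrightarrow> \<exists>y. w = act y v"
proof -
  assume v: "v \<noteq> 0"
  let ?W = "range (\<lambda>y. act y v)"
  have "left_submodule act ?W"
    unfolding left_submodule_def
    by (auto simp: act_add_left[symmetric] act_mult[symmetric] intro: range_eqI[of 0 _ 0])
      (metis act_zero(1) rangeI)
  moreover have "v \<in> ?W" using act_one[of v] by (metis rangeI)
  ultimately have "?W = UNIV" using simple v by blast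
  thus ?thesis by blast
qed

text \<open>
  If \<open>y \<noteq> 0\<close> annihilated \<open>V\<close>, then so would the two-sided ideal of \<open>y\<close>.  That ideal contains a nonzero
  multiple of every \<open>E k\<close>, because the algebra is prime and \<open>E k\<close> has rank one; but the \<open>E k\<close> add up to \<open>1\<close>.
\<close>
lemma act_faithful:
  assumes idem: "idempotents_for d scale rep x E \<theta>" and y: "y \<noteq> 0"
  shows "\<exists>v. act y v \<noteq> 0"
proof (rule ccontr)
  assume "\<not> ?thesis"
  hence 0: "act y v = 0" for v by blast
  have "act (E k) v = 0" if k: "k \<le> d" for k v
  proof -
    obtain a where a: "E k * a * y \<noteq> 0" using prime_algebra[OF idempotents_nonzero[OF idem k] y] by blast
    obtain b where b: "E k * a * y * b * E k \<noteq> 0"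
      using prime_algebra[OF a idempotents_nonzero[OF idem k]] by blast
    define c where "c = mat_trace (rep (a * y * b * E k))"
    have c: "E k * a * y * b * E k = scale c (E k)"
      using idempotents_trace[OF idem k, of "a * y * b"] by (simp add: c_def mult.assoc)
    hence "c \<noteq> 0" using b by auto
    moreover have "vscale c (act (E k) v) = 0"
      using arg_cong[OF c, of "\<lambda>z. act z v"] by (simp add: act_mult act_scale_left 0 act_zero)
    ultimately show ?thesis by simp
  qed
  hence "act (\<Sum>k\<le>d. E k) v = 0" for v by (simp add: act_sum_left)
  thus False using nontrivial by (simp add: idempotents_sum[OF idem] act_one)
qed

lemma act_eqI:
  assumes "idempotents_for d scale rep x E \<theta>" "\<And>v. act y v = act z v" shows "y = z"
  using act_faithful[OF assms(1), of "y - z"] assms(2) by (auto simp: act_diff_left)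

lemma eigenspaces_act:
  assumes idem: "idempotents_for d scale rep x E \<theta>"
  shows "eigenspaces vscale d (\<lambda>i. act (E i)) \<theta>"
proof (intro eigenspaces.intro eigenspaces_axioms.intro V.vector_space_axioms)
  show "inj_on \<theta> {..d}"
    using idem by (auto simp: idempotents_for_def eigenvalue_ordering_def bij_betw_def)
  show "act (E i) (act (E j) v) = (if i = j then act (E j) v else 0)" if "i \<le> d" "j \<le> d" for i j v
    using that by (simp add: act_mult[symmetric] idempotents_mult[OF idem] act_zero)
  show "(\<Sum>i\<le>d. act (E i) v) = v" for v
    by (simp add: act_sum_left[symmetric] idempotents_sum[OF idem] act_one)
  show "\<exists>v. act (E i) v \<noteq> 0" if "i \<le> d" for i
    by (rule act_faithful[OF idem idempotents_nonzero[OF idem that]])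
  show "\<exists>c. act (E i) y = vscale c (act (E i) w)" if i: "i \<le> d" and w: "act (E i) w \<noteq> 0" for i w y
  proof -
    obtain z where "y = act z (act (E i) w)" using act_generates[OF w] by blast
    hence "act (E i) y = act (E i * z * E i) w" by (simp add: act_mult)
    thus ?thesis unfolding idempotents_trace[OF idem i] act_scale_left by blast
  qed
qed (rule act_linear)

lemma act_combination:
  "act (\<Sum>r\<le>d. scale (g r) (E r)) v = diag_op vscale d (\<lambda>i. act (E i)) g v"
  by (simp add: diag_op_def act_sum_left act_scale_left)

lemma act_diag_op:
  assumes idem: "idempotents_for d scale rep x E \<theta>"
  shows "diag_op vscale d (\<lambda>i. act (E i)) \<theta> = act x"
proof
  fix v
  have "x = (\<Sum>i\<le>d. x * E i)"
    using idempotents_sum[OF idem] by (simp add: sum_distrib_left[symmetric])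
  also have "\<dots> = (\<Sum>i\<le>d. scale (\<theta> i) (E i))" by (simp add: idempotents_eigen[OF idem])
  finally show "diag_op vscale d (\<lambda>i. act (E i)) \<theta> v = act x v"
    using act_combination[of \<theta> E v] by simp
qed

lemma alg_inverse_combination:
  assumes idem: "idempotents_for d scale rep x E \<theta>" and g: "\<And>r. r \<le> d \<Longrightarrow> g r \<noteq> 0"
  shows "alg_inverse (\<Sum>r\<le>d. scale (g r) (E r)) = (\<Sum>r\<le>d. scale (inverse (g r)) (E r))"
proof -
  interpret eigenspaces vscale d "\<lambda>i. act (E i)" \<theta> by (rule eigenspaces_act[OF idem])
  have "diag_op vscale d (\<lambda>i. act (E i)) g (diag_op vscale d (\<lambda>i. act (E i)) (\<lambda>r. inverse (g r)) v) = v" for v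
    by (rule E_ext) (simp add: E_diag g)
  thus ?thesis
    by (intro alg_inverse_eq act_eqI[OF idem])
      (simp_all add: act_mult act_combination act_one diag_commute[of "\<lambda>r. inverse (g r)" g])
qed

lemma eigval_eq:
  assumes idem: "idempotents_for d scale rep (elt \<Phi>) (idem \<Phi>) \<theta>" and i: "i \<le> d"
  shows "eigval d scale rep \<Phi> i = \<theta> i"
  unfolding eigval_def
proof (rule the_equality)
  fix t assume "\<exists>\<theta>. idempotents_for d scale rep (elt \<Phi>) (idem \<Phi>) \<theta> \<and> \<theta> i = t"
  then obtain \<theta>2 where t: "idempotents_for d scale rep (elt \<Phi>) (idem \<Phi>) \<theta>2" "\<theta>2 i = t" by blast
  have "scale t (idem \<Phi> i) = scale (\<theta> i) (idem \<Phi> i)"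
    using idempotents_eigen[OF t(1) i] idempotents_eigen[OF idem i] t(2) by metis
  thus "t = \<theta> i" using idempotents_nonzero[OF idem i] by (metis scale_cancel_right)
qed (use idem in blast)

text \<open>
  Since \<^const>\<open>eigval\<close> is itself an admissible ordering of the eigenvalues, the split sequences, which
  refer to it, need no change of ordering below.
\<close>
lemma idempotents_for_eigval:
  assumes idem: "idempotents_for d scale rep (elt \<Phi>) (idem \<Phi>) \<theta>"
  shows "idempotents_for d scale rep (elt \<Phi>) (idem \<Phi>) (eigval d scale rep \<Phi>)"
proof -
  have "primitive_idempotent d scale (elt \<Phi>) (eigval d scale rep \<Phi>) i
      = primitive_idempotent d scale (elt \<Phi>) \<theta> i" if "i \<le> d" for i
    unfolding primitive_idempotent_def
    by (intro arg_cong[of _ _ prod_list] map_cong refl) (use eigval_eq[OF idem] that in \<open>auto simp del: upt_Suc\<close>)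
  moreover have "bij_betw (eigval d scale rep \<Phi>) {..d} = bij_betw \<theta> {..d}"
    by (intro ext bij_betw_cong) (use eigval_eq[OF idem] in auto)
  ultimately show ?thesis using idem by (simp add: idempotents_for_def eigenvalue_ordering_def)
qed

lemma tridiagonal_act:
  assumes E: "idempotents_for d scale rep x E \<theta>" and F: "idempotents_for d scale rep y F \<theta>'"
    and pattern: "tridiagonal_pattern d F x"
  shows "tridiagonal_action vscale d (\<lambda>i. act (E i)) \<theta> (\<lambda>i. act (F i)) \<theta>'"
proof (intro tridiagonal_action.intro tridiagonal_action_axioms.intro eigenspaces_act[OF E] eigenspaces_act[OF F])
  have act: "act (F i) (diag_op vscale d (\<lambda>i. act (E i)) \<theta> (act (F j) v)) = act (F i * x * F j) v" for i j v
    by (simp add: act_diag_op[OF E] act_mult)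
  show "act (F i) (diag_op vscale d (\<lambda>i. act (E i)) \<theta> (act (F j) v)) = 0"
    if "i \<le> d" "j \<le> d" "i + 1 < j \<or> j + 1 < i" for i j v
  proof -
    have "\<bar>int i - int j\<bar> > 1" using that by auto
    hence "F i * x * F j = 0" using pattern that unfolding tridiagonal_pattern_def by blast
    thus ?thesis by (simp add: act act_zero)
  qed
  show "\<exists>v. act (F i) (diag_op vscale d (\<lambda>i. act (E i)) \<theta> (act (F j) v)) \<noteq> 0"
    if "i \<le> d" "j \<le> d" "i = j + 1 \<or> j = i + 1" for i j
  proof -
    have "\<bar>int i - int j\<bar> = 1" using that by auto
    hence "F i * x * F j \<noteq> 0" using pattern that unfolding tridiagonal_pattern_def by blast
    thus ?thesis using act_faithful[OF E] by (simp add: act)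
  qed
qed

lemma leonard_system_idempotents:
  assumes "leonard_system d scale rep \<Phi>"
  shows "idempotents_for d scale rep (elt \<Phi>) (idem \<Phi>) (eigval d scale rep \<Phi>)"
    and "idempotents_for d scale rep (elt_dual \<Phi>) (idem_dual \<Phi>) (eigval d scale rep (dual \<Phi>))"
  using assms idempotents_for_eigval[of \<Phi>] idempotents_for_eigval[of "dual \<Phi>"]
  by (auto simp: leonard_system_def dual_def)

lemma leonard_act:
  assumes "leonard_system d scale rep \<Phi>"
  shows "leonard vscale d (\<lambda>i. act (idem \<Phi> i)) (eigval d scale rep \<Phi>)
           (\<lambda>i. act (idem_dual \<Phi> i)) (eigval d scale rep (dual \<Phi>))"
  using assms
  by (intro leonard.intro tridiagonal_act[OF leonard_system_idempotents[OF assms]]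
      tridiagonal_act[OF leonard_system_idempotents(2,1)[OF assms]]) (auto simp: leonard_system_def)

lemma poly_eval_bound:
  assumes "degree p \<le> m" shows "poly_eval scale p x = (\<Sum>n\<le>m. scale (coeff p n) (x ^ n))"
  unfolding poly_eval_def
  by (rule sum.mono_neutral_left) (use assms in \<open>auto simp: coeff_eq_0\<close>)

lemma poly_eval_linear_factor:
  "poly_eval scale (p * [:- c, 1:]) x = x * poly_eval scale p x - scale c (poly_eval scale p x)"
proof -
  let ?m = "Suc (degree p)"
  have p: "p * [:- c, 1:] = pCons 0 p - Polynomial.smult c p" by (simp add: mult.commute)
  have "degree (pCons 0 p - Polynomial.smult c p) \<le> ?m"
    by (intro degree_diff_le order.trans[OF degree_smult_le]) (auto simp: degree_pCons_eq_if)
  hence "poly_eval scale (p * [:- c, 1:]) x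
      = (\<Sum>n\<le>?m. scale (coeff (pCons 0 p) n) (x ^ n)) - (\<Sum>n\<le>?m. scale (c * coeff p n) (x ^ n))"
    unfolding p by (subst poly_eval_bound) (auto simp: scale_left_diff_distrib sum_subtractf)
  also have "(\<Sum>n\<le>?m. scale (coeff (pCons 0 p) n) (x ^ n)) = x * poly_eval scale p x"
    by (subst sum.atMost_Suc_shift) (simp add: poly_eval_def sum_distrib_left scale_mult_right)
  also have "(\<Sum>n\<le>?m. scale (c * coeff p n) (x ^ n)) = scale c (poly_eval scale p x)"
    by (subst poly_eval_bound[of p ?m]) (auto simp: scale_sum_right simp del: sum.atMost_Suc)
  finally show ?thesis .
qed

lemma act_tau: "act (poly_eval scale (tau t n) x) v = newton vscale (act x) t n v"
proof (induction n)
  case 0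
  show ?case by (simp add: tau_def poly_eval_def act_one)
next
  case (Suc n)
  have "tau t (Suc n) = tau t n * [:- t n, 1:]" by (simp add: tau_def)
  thus ?case using Suc by (simp only: poly_eval_linear_factor newton.simps act_diff_left act_mult act_scale_left)
qed

lemma act_corner:
  assumes "idempotents_for d scale rep x F \<theta>" "i \<le> d" "act (F i) v = v"
  shows "act (F i) (act y v) = vscale (mat_trace (rep (y * F i))) v"
proof -
  have "act (F i) (act y v) = act (F i * y * F i) v" using assms(3) by (simp add: act_mult)
  thus ?thesis unfolding idempotents_trace[OF assms(1,2)] using assms(3) by (simp add: act_scale_left)
qed

text \<open>
  The traces in the definition of the split sequences are the \<open>F 0\<close>-coordinates required by
  \<open>split_sequenceI\<close>, as \<open>F 0 \<cdot> y \<cdot> F 0\<close> is the trace of \<open>y \<cdot> F 0\<close> times \<open>F 0\<close>.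
\<close>
lemma split_sequences_act:
  fixes \<Phi> :: "'a leonard_data"
  defines "E \<equiv> \<lambda>i. act (idem \<Phi> i)" and "F \<equiv> \<lambda>i. act (idem_dual \<Phi> i)"
    and "\<theta> \<equiv> eigval d scale rep \<Phi>" and "\<theta>' \<equiv> eigval d scale rep (dual \<Phi>)"
  assumes \<Phi>: "leonard_system d scale rep \<Phi>"
  shows "split_sequence vscale d E \<theta> F \<theta>' (first_split d scale rep \<Phi>)"
    and "split_sequence vscale d (flip d E) (flip d \<theta>) F \<theta>' (second_split d scale rep \<Phi>)"
proof -
  interpret leonard vscale d E \<theta> F \<theta>'
    unfolding E_def F_def \<theta>_def \<theta>'_def by (rule leonard_act[OF \<Phi>])
  interpret fl: leonard vscale d "flip d E" "flip d \<theta>" F \<theta>' by (rule flip_E)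
  have A: "diag_op vscale d E \<theta> = act (elt \<Phi>)"
    unfolding E_def \<theta>_def by (rule act_diag_op[OF leonard_system_idempotents(1)[OF \<Phi>]])
  define tr where "tr p = mat_trace (rep (poly_eval scale p (elt \<Phi>) * idem_dual \<Phi> 0))" for p
  have tr: "F 0 (newton vscale (act (elt \<Phi>)) t n v) = vscale (tr (tau t n)) v" if "F 0 v = v" for t n v
    using act_corner[OF leonard_system_idempotents(2)[OF \<Phi>], of 0 v] that
    unfolding F_def tr_def act_tau[symmetric] by simp
  show "split_sequence vscale d E \<theta> F \<theta>' (first_split d scale rep \<Phi>)"
  proof (rule split_sequenceI)
    show "F 0 (newton vscale (diag_op vscale d E \<theta>) \<theta> i v) = vscale (tr (tau \<theta> i)) v"
      if "F 0 v = v" for v i using tr[OF that] by (simp add: A)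
  qed (simp add: first_split_def Let_def tr_def \<theta>_def \<theta>'_def)
  have eta: "eta d \<theta> n = tau (flip d \<theta>) n" for n by (simp add: eta_def tau_def)
  show "split_sequence vscale d (flip d E) (flip d \<theta>) F \<theta>' (second_split d scale rep \<Phi>)"
  proof (rule fl.split_sequenceI)
    show "F 0 (newton vscale (diag_op vscale d (flip d E) (flip d \<theta>)) (flip d \<theta>) i v)
        = vscale (tr (tau (flip d \<theta>) i)) v" if "F 0 v = v" for v i
      using tr[OF that] by (simp add: A diag_op_flip)
  qed (simp add: second_split_def Let_def tr_def \<theta>_def[symmetric] \<theta>'_def eta)
qed

lemma sum_ranges_vanish:
  assumes idem: "idempotents_for d scale rep x E \<theta>"
    and v: "v \<in> (\<Sum>j\<le>i. range (act (E (f j))))" and "i \<le> d" "\<And>j. j \<le> i \<Longrightarrow> f j \<le> d"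
    and "k \<le> d" "\<And>j. j \<le> i \<Longrightarrow> f j \<noteq> k"
  shows "act (E k) v = 0"
proof -
  obtain s where s: "v = sum s {..i}" "\<forall>j\<in>{..i}. s j \<in> range (act (E (f j)))"
    using v by (auto simp: set_sum_alt)
  interpret eigenspaces vscale d "\<lambda>i. act (E i)" \<theta> by (rule eigenspaces_act[OF idem])
  have "act (E k) (s j) = 0" if j: "j \<le> i" for j
  proof -
    obtain w where "s j = act (E (f j)) w" using s(2) j by auto
    thus ?thesis using E_E[of k "f j" w] assms j by auto
  qed
  thus ?thesis using assms by (simp add: s(1) E_simps)
qed

end


section \<open>Eigenvalues of the commutators\<close>
lemma prod_split: "i \<le> d \<Longrightarrow> (\<Prod>j\<in>{1..d}. f j) = (\<Prod>j\<in>{1..i}. f j) * (\<Prod>j\<in>{i + 1..d}. f j)"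
  for f :: "nat \<Rightarrow> 'k::comm_monoid_mult" and d :: nat
  using prod.ub_add_nat[of 1 i f "d - i"] by simp

theorem theorem11p7:
  fixes d :: nat
    and scale :: "'k::field \<Rightarrow> 'a::ring_1 \<Rightarrow> 'a"
    and rep :: "'a \<Rightarrow> 'k mat"
    and act :: "'a \<Rightarrow> 'v::ab_group_add \<Rightarrow> 'v"
    and \<Phi> :: "'a leonard_data"
    and \<theta> \<theta>' \<phi>\<^sub>1 \<phi>\<^sub>2 :: "nat \<Rightarrow> 'k"
    and S S' :: 'a
    and i :: nat
  assumes "full_matrix_algebra d scale rep"
    and "simple_left_module act"
    and "leonard_system d scale rep \<Phi>"
    and "parameter_array d scale rep \<Phi> \<theta> \<theta>' \<phi>\<^sub>1 \<phi>\<^sub>2"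
    and "S = switching_element d scale rep \<Phi>"
    and "S' = dual_switching_element d scale rep \<Phi>"
    and "i \<le> d"
  shows
    "acts_as_scalar scale act (S' * alg_inverse S * alg_inverse S' * S)
       (decomposition d act \<Phi> F0' FD i)
       (((\<Prod>j\<in>{1..i}. \<phi>\<^sub>2 j) / (\<Prod>j\<in>{1..i}. \<phi>\<^sub>1 j)) *
        ((\<Prod>j\<in>{1..d - i}. \<phi>\<^sub>1 j) / (\<Prod>j\<in>{1..d - i}. \<phi>\<^sub>2 j)))
     \<and> acts_as_scalar scale act (S' * S * alg_inverse S' * alg_inverse S)
       (decomposition d act \<Phi> FD' FD i)
       (((\<Prod>j\<in>{d - i + 1..d}. \<phi>\<^sub>1 j) / (\<Prod>j\<in>{d - i + 1..d}. \<phi>\<^sub>2 j)) *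
        ((\<Prod>j\<in>{i + 1..d}. \<phi>\<^sub>2 j) / (\<Prod>j\<in>{i + 1..d}. \<phi>\<^sub>1 j)))
     \<and> acts_as_scalar scale act (alg_inverse S' * alg_inverse S * S' * S)
       (decomposition d act \<Phi> F0' F0 i)
       (((\<Prod>j\<in>{1..i}. \<phi>\<^sub>1 j) / (\<Prod>j\<in>{1..i}. \<phi>\<^sub>2 j)) *
        ((\<Prod>j\<in>{1..d - i}. \<phi>\<^sub>2 j) / (\<Prod>j\<in>{1..d - i}. \<phi>\<^sub>1 j)))
     \<and> acts_as_scalar scale act (alg_inverse S' * S * S' * alg_inverse S)
       (decomposition d act \<Phi> FD' F0 i)
       (((\<Prod>j\<in>{d - i + 1..d}. \<phi>\<^sub>2 j) / (\<Prod>j\<in>{d - i + 1..d}. \<phi>\<^sub>1 j)) *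
        ((\<Prod>j\<in>{i + 1..d}. \<phi>\<^sub>1 j) / (\<Prod>j\<in>{i + 1..d}. \<phi>\<^sub>2 j)))"
proof -
  interpret full_matrix_algebra d scale rep by fact
  interpret simple_left_module act by fact
  interpret matrix_algebra_module d scale rep act ..
  note \<Phi> = assms(3) and i = assms(7)
  have \<Phi>': "leonard_system d scale rep (dual \<Phi>)"
    using \<Phi> by (auto simp: leonard_system_def dual_def)
  note idem = leonard_system_idempotents[OF \<Phi>]
  let ?E = "\<lambda>i. act (idem \<Phi> i)" and ?F = "\<lambda>i. act (idem_dual \<Phi> i)"
  let ?th = "eigval d scale rep \<Phi>" and ?th' = "eigval d scale rep (dual \<Phi>)"
  let ?ph = "first_split d scale rep \<Phi>" and ?ps = "second_split d scale rep \<Phi>"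
  let ?ph' = "first_split d scale rep (dual \<Phi>)" and ?ps' = "second_split d scale rep (dual \<Phi>)"
  let ?g = "switch_coeff d ?ph' ?ps'"
  have dual_sel: "idem (dual \<Phi>) = idem_dual \<Phi>" "idem_dual (dual \<Phi>) = idem \<Phi>" "dual (dual \<Phi>) = \<Phi>"
    by (simp_all add: dual_def)
  interpret L: leonard vscale d ?E ?th ?F ?th' by (rule leonard_act[OF \<Phi>])
  interpret L': leonard vscale d ?F ?th' ?E ?th by (rule L.dual)
  interpret L'f: leonard vscale d "flip d ?F" "flip d ?th'" ?E ?th by (rule L'.flip_E)
  note split' = split_sequences_act[OF \<Phi>', unfolded dual_sel]
  \<comment> \<open>\<open>S'\<close> is the switching element of the dual system, so its swap property is lemma \<open>switching\<close> there\<close>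
  interpret leonard_switching vscale d ?E ?th ?F ?th' ?ph ?ps ?g
  proof
    show "?g r \<noteq> 0" if "r \<le> d" for r
      using that L'.split_sequence_nonzero[OF split'(1)] L'f.split_sequence_nonzero[OF split'(2)]
      by (rule switch_coeff_nonzero)
  qed (use split_sequences_act[OF \<Phi>] L'.switching[OF split'] in auto)

  have S: "S = (\<Sum>r\<le>d. scale (s r) (idem \<Phi> r))"
    by (simp add: assms(5) switching_element_def switch_coeff_def)
  have S': "S' = (\<Sum>r\<le>d. scale (?g r) (idem_dual \<Phi> r))"
    by (simp add: assms(6) dual_switching_element_def switching_element_def switch_coeff_def dual_sel)
  have inv: "alg_inverse S = (\<Sum>r\<le>d. scale (inverse (s r)) (idem \<Phi> r))"
    "alg_inverse S' = (\<Sum>r\<le>d. scale (inverse (?g r)) (idem_dual \<Phi> r))"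
    unfolding S S' by (rule alg_inverse_combination[OF idem(1) s_nonzero]
        alg_inverse_combination[OF idem(2) g_nonzero]; assumption)+
  have act_S: "act S = diag_op vscale d ?E s" "act S' = diag_op vscale d ?F ?g"
    "act (alg_inverse S) = diag_op vscale d ?E (\<lambda>r. inverse (s r))"
    "act (alg_inverse S') = diag_op vscale d ?F (\<lambda>r. inverse (?g r))"
    unfolding inv by (simp_all add: fun_eq_iff S S' act_combination)

  have flag_vanish:
    "v \<in> flag d act \<Phi> F0' i \<Longrightarrow> j \<le> d \<Longrightarrow> i < j \<Longrightarrow> ?F j v = 0"
    "v \<in> flag d act \<Phi> FD' i \<Longrightarrow> j \<le> d \<Longrightarrow> i < j \<Longrightarrow> ?F (d - j) v = 0"
    "v \<in> flag d act \<Phi> F0 (d - i) \<Longrightarrow> j < i \<Longrightarrow> ?E (d - j) v = 0"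
    "v \<in> flag d act \<Phi> FD (d - i) \<Longrightarrow> j < i \<Longrightarrow> ?E j v = 0" for v j
    using i by (auto elim!: sum_ranges_vanish[OF idem(1)] sum_ranges_vanish[OF idem(2)])

  have \<phi>: "?ph j = \<phi>\<^sub>1 j" "?ps j = \<phi>\<^sub>2 j" if "j \<in> {1..d}" for j
    using assms(4) that by (auto simp: parameter_array_def)
  have \<phi>_nonzero: "\<phi>\<^sub>1 j \<noteq> 0" "\<phi>\<^sub>2 j \<noteq> 0" if "j \<in> {1..d}" for j
    using ph_nonzero[OF that] ps_nonzero[OF that] \<phi>[OF that] by auto
  have \<alpha>: "\<alpha> k = (\<Prod>j\<in>{1..k}. \<phi>\<^sub>2 j) / (\<Prod>j\<in>{1..k}. \<phi>\<^sub>1 j)" if "k \<le> d" for k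
    unfolding \<alpha>_def prod_dividef using that \<phi> by (auto intro!: arg_cong2[of _ _ _ _ "(/)"] prod.cong)
  have tail: "(\<Prod>j\<in>{k + 1..d}. \<phi>\<^sub>2 j) / (\<Prod>j\<in>{k + 1..d}. \<phi>\<^sub>1 j) = \<alpha> d / \<alpha> k" if "k \<le> d" for k
  proof -
    have "(\<Prod>j\<in>{1..k}. \<phi>\<^sub>1 j) \<noteq> 0" "(\<Prod>j\<in>{1..k}. \<phi>\<^sub>2 j) \<noteq> 0" using \<phi>_nonzero that by auto
    thus ?thesis unfolding \<alpha>[OF that] \<alpha>[OF order_refl] prod_split[OF that] by simp
  qed
  have tail': "(\<Prod>j\<in>{k + 1..d}. \<phi>\<^sub>1 j) / (\<Prod>j\<in>{k + 1..d}. \<phi>\<^sub>2 j) = \<alpha> k / \<alpha> d" if "k \<le> d" for k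
    using arg_cong[OF tail[OF that], of inverse] by simp
  have head': "(\<Prod>j\<in>{1..k}. \<phi>\<^sub>1 j) / (\<Prod>j\<in>{1..k}. \<phi>\<^sub>2 j) = inverse (\<alpha> k)" if "k \<le> d" for k
    by (simp add: \<alpha> that)
  have nz: "\<alpha> i \<noteq> 0" "\<alpha> (d - i) \<noteq> 0" "\<alpha> d \<noteq> 0" using \<alpha>_nonzero i by auto

  show ?thesis
    unfolding acts_as_scalar_def decomposition_def act_scale_left act_mult act_S act_one
  proof (intro conjI ballI; elim IntE)
    fix v assume v: "v \<in> flag d act \<Phi> F0' i" "v \<in> flag d act \<Phi> FD (d - i)"
    show "G (S_inv (G_inv (diag_op vscale d ?E s v))) = vscale (((\<Prod>j\<in>{1..i}. \<phi>\<^sub>2 j) / (\<Prod>j\<in>{1..i}. \<phi>\<^sub>1 j)) *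
        ((\<Prod>j\<in>{1..d - i}. \<phi>\<^sub>1 j) / (\<Prod>j\<in>{1..d - i}. \<phi>\<^sub>2 j))) v"
      unfolding \<alpha>[OF i, symmetric] head'[OF diff_le_self]
      using commutator_0'D[OF i flag_vanish(1)[OF v(1)] flag_vanish(4)[OF v(2)]]
      by (simp add: divide_inverse)
  next
    fix v assume v: "v \<in> flag d act \<Phi> FD' i" "v \<in> flag d act \<Phi> FD (d - i)"
    show "G (diag_op vscale d ?E s (G_inv (S_inv v))) = vscale (((\<Prod>j\<in>{d - i + 1..d}. \<phi>\<^sub>1 j) / (\<Prod>j\<in>{d - i + 1..d}. \<phi>\<^sub>2 j)) *
        ((\<Prod>j\<in>{i + 1..d}. \<phi>\<^sub>2 j) / (\<Prod>j\<in>{i + 1..d}. \<phi>\<^sub>1 j))) v"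
      unfolding tail[OF i] tail'[OF diff_le_self]
      using commutator_D'D[OF i flag_vanish(2)[OF v(1)] flag_vanish(4)[OF v(2)]] nz by simp
  next
    fix v assume v: "v \<in> flag d act \<Phi> F0' i" "v \<in> flag d act \<Phi> F0 (d - i)"
    show "G_inv (S_inv (G (diag_op vscale d ?E s v))) = vscale (((\<Prod>j\<in>{1..i}. \<phi>\<^sub>1 j) / (\<Prod>j\<in>{1..i}. \<phi>\<^sub>2 j)) *
        ((\<Prod>j\<in>{1..d - i}. \<phi>\<^sub>2 j) / (\<Prod>j\<in>{1..d - i}. \<phi>\<^sub>1 j))) v"
      unfolding \<alpha>[OF diff_le_self, symmetric] head'[OF i]
      using commutator_0'0[OF i flag_vanish(1)[OF v(1)] flag_vanish(3)[OF v(2)]]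
      by (simp add: divide_inverse mult.commute)
  next
    fix v assume v: "v \<in> flag d act \<Phi> FD' i" "v \<in> flag d act \<Phi> F0 (d - i)"
    show "G_inv (diag_op vscale d ?E s (G (S_inv v))) = vscale (((\<Prod>j\<in>{d - i + 1..d}. \<phi>\<^sub>2 j) / (\<Prod>j\<in>{d - i + 1..d}. \<phi>\<^sub>1 j)) *
        ((\<Prod>j\<in>{i + 1..d}. \<phi>\<^sub>1 j) / (\<Prod>j\<in>{i + 1..d}. \<phi>\<^sub>2 j))) v"
      unfolding tail'[OF i] tail[OF diff_le_self]
      using commutator_D'0[OF i flag_vanish(2)[OF v(1)] flag_vanish(3)[OF v(2)]] nz by simp
  qed
qed

end
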